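(* Assume: (A1) the solution set $S_1$ of the variational inequality is nonempty; (A3) $F$ has a stochastic oracle $F_\xi$ that is variable $\bar L$-Lipschitz in mean; (A4) $\|F(x)-F(y)\|_*\le L\|x-y\|$ for all $x,y\in K$; (A5) there exist $x^*\in K$ and $\rho>0$ such that $-\rho\|w\|_*^2\le\langle w,x-x^*\rangle$ for all $x\in K$ and all $w\in F(x)+\partial(g+\mathrm I_K)(x)$; (A6) for some $L_f>0$, $\|\nabla f(x)-\nabla f(y)\|_*\le L_f\|x-y\|$ for all $x,y\in K$. Let $\{x_s\}$ be generated by the algorithm with $0<p<1$ and $p<\gamma<1$. Set $$\sigma_1=\frac{1-\gamma}{2(1-p)}\left(1-\frac{8\rho L_f^2}{\alpha}\right)-\left(2\alpha^2L^2+8\alpha\rho L^2+\frac{4\alpha\rho\bar L^2}{b}+\frac{5\alpha^2\bar L^2}{2b}\right),$$ $$\sigma_2=8L^2+\frac{4(1-\gamma)L_f^2}{(1-p)\alpha^2}+\frac{4\bar L^2}{b}.$$ If $\sigma_1>0$ and $$\frac{8(\gamma-p)L_f^2}{(1-p)\alpha^2}-\frac{\sigma_2}{\sigma_1}\left(\frac{\gamma-p}{1-p}\left(1-\frac{8\rho L_f^2}{\alpha}\right)-\frac12\right)\le0,$$ then $$\mathbb E\left[\sum_{s=0}^{S-1}\|u_s\|_*^2\right]\le\frac{(3-\gamma)\sigma_2}{\sigma_1}D(x^*,x_0),$$ where $u_s=F(x_{s+1})-\Delta^s-\frac1\alpha\Big(\nabla f(x_{s+1})-\big(\gamma\nabla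 f(x_s)+(1-\gamma)\nabla f(x_{s-1})\big)\Big)$.
   Context: Setting. $\mathcal X$ is a finite-dimensional space with inner product $\langle\cdot,\cdot\rangle$ and a norm $\|\cdot\|$ with dual norm $\|\cdot\|_*$. $K\subset\mathcal X$ is nonempty, closed and convex, with indicator function $\mathrm I_K$ ($0$ on $K$, $+\infty$ elsewhere); $g:K\to(-\infty,+\infty]$ is proper, convex, lower semicontinuous; $F:\mathrm{dom}\,g\to\mathcal X$ is an operator of the form $F=\frac1M\sum_{i=1}^M F_i$. The variational inequality is: find $x^*\in K$ with $\langle F(x^* ),y-x^*\rangle+g(y)-g(x^* )\ge 0$ for all $y\in K$; $S_1$ is its solution set. $\partial$ denotes the convex subdifferential. Bregman distance. $f:K\to(-\infty,+\infty]$ is proper, convex, lower semicontinuous, $\mathrm{dom}\,g\subset\mathrm{dom}\,f$, $f$ is differentiable on $\mathrm{dom}(\partial f)=\{x\in\mathrm{dom} f:\partial f(x)\ne\emptyset\}$ and 1-strongly convex: $f(x)\ge f(y)+\langle\nabla f(y),x-y\rangle+\frac12\|x-y\|^2$ for $x\in\mathrm{dom} f$, $y\in\mathrm{dom}(\partial f)$. $D(x,y)=f(x)-f(y)-\langle\nabla f(y),x-y\rangle$ for $x\in\mathrm{dom}\,g$, $y\in\mathrm{dom}(\partial f)$. Stochastic oracle. $F$ has a stochastic oracle $F_\xi$ that is variable $\bar L$-Lipschitz in mean if for any $x,y\in\mathrm{dom}\,g$ there is a distribution $Q_{x,y}$ of $\xi$ such that (i) $F(z)=\mathbb E_{\xi\sim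 Q_{x,y}}[F_\xi(z)]$ for all $z\in\mathrm{dom}\,g$; (ii) $\mathbb E_{\xi\sim Q_{x,y}}[\|F_\xi(x)-F_\xi(y)\|_*^2]\le\bar L^2\|x-y\|^2$. Algorithm. Parameters: $0<\gamma\le1$, $0<p\le1$, stepsize $\alpha>0$, batch size $b\in\{1,\dots,M\}$. Start with $x_0=x_{-1}=w_0=w_{-1}\in K$. For $s=0,1,\dots,S-1$: draw $\xi^s_1,\dots,\xi^s_b\in\{1,\dots,M\}$ independently from $Q_{x_s,w_{s-1}}$ and set $B^s=\{\xi_1^s,\dots,\xi_b^s\}$ (with multiplicity); set $\bar x_s=(\nabla f)^{-1}\big(\gamma\nabla f(x_s)+(1-\gamma)\nabla f(x_{s-1})\big)$; $\Delta^s=\frac1b\sum_{\xi\in B^s}\big(F(w_s)+F_\xi(x_s)-F_\xi(w_{s-1})\big)$; $x_{s+1}=\arg\min_{x\in K}\{\alpha g(x)+\langle\alpha\Delta^s,x\rangle+D(x,\bar x_s)\}$; and let $w_{s+1}=x_{s+1}$ with probability $p$ and $w_{s+1}=x_s$ with probability $1-p$ (fresh independent coin). All iterates are assumed well defined, i.e. the points used as second arguments of $D$ lie in $\mathrm{dom}(\partial f)$. *)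

theory Defs
  imports "HOL-Probability.Probability"
begin

subsection \<open>Norms and convex analysis on a closed convex set\<close>

definition is_norm :: "('a::real_vector \<Rightarrow> real) \<Rightarrow> bool" where
  "is_norm N \<longleftrightarrow>
     (\<forall>x. N x = 0 \<longleftrightarrow> x = 0) \<and>
     (\<forall>x y. N (x + y) \<le> N x + N y) \<and>
     (\<forall>c x. N (c *\<^sub>R x) = \<bar>c\<bar> * N x)"

definition dual_norm :: "('a::real_inner \<Rightarrow> real) \<Rightarrow> 'a \<Rightarrow> real" where
  "dual_norm N w = (SUP x\<in>{x. N x \<le> 1}. w \<bullet> x)"

text \<open>A function from \<open>K\<close> to the extended reals is represented by a total function of which only
  the values on \<open>K\<close> are used; adding \<open>indicator_ext K\<close> turns it into the usual extension by
  infinity (for extended reals, adding positive infinity always gives positive infinity).\<close>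

definition indicator_ext :: "'a set \<Rightarrow> 'a \<Rightarrow> ereal" where
  "indicator_ext K x = (if x \<in> K then 0 else \<infinity>)"

definition edom :: "'a set \<Rightarrow> ('a \<Rightarrow> ereal) \<Rightarrow> 'a set" where
  "edom K h = {x \<in> K. h x < \<infinity>}"

definition proper_convex_lsc :: "'a::euclidean_space set \<Rightarrow> ('a \<Rightarrow> ereal) \<Rightarrow> bool" where
  "proper_convex_lsc K h \<longleftrightarrow>
     (\<forall>x\<in>K. h x \<noteq> -\<infinity>) \<and> edom K h \<noteq> {} \<and>
     (\<forall>x\<in>K. \<forall>y\<in>K. \<forall>t\<in>{0<..<1}.
        h ((1 - t) *\<^sub>R x + t *\<^sub>R y) \<le> ereal (1 - t) * h x + ereal t * h y) \<and>
     (\<forall>x\<in>K. h x \<le> Liminf (at x within K) h)"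

definition subdifferential :: "('a::real_inner \<Rightarrow> ereal) \<Rightarrow> 'a \<Rightarrow> 'a set" where
  "subdifferential h x = {v. \<bar>h x\<bar> \<noteq> \<infinity> \<and> (\<forall>y. h x + ereal (v \<bullet> (y - x)) \<le> h y)}"

definition dom_subdiff :: "'a::real_inner set \<Rightarrow> ('a \<Rightarrow> ereal) \<Rightarrow> 'a set" where
  "dom_subdiff K h = {x \<in> edom K h. subdifferential (\<lambda>z. h z + indicator_ext K z) x \<noteq> {}}"

subsection \<open>Variational inequality\<close>

text \<open>A solution automatically lies in the domain of a proper \<open>g\<close>: if \<open>g x\<close> is infinite and
  \<open>g y\<close> is finite, then \<open>g y - g x\<close> is negative infinity.\<close>

definition vi_solutions :: "'a::real_inner set \<Rightarrow> ('a \<Rightarrow> ereal) \<Rightarrow> ('a \<Rightarrow> 'a) \<Rightarrow> 'a set" where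
  "vi_solutions K g F = {x \<in> K. \<forall>y\<in>K. 0 \<le> ereal (F x \<bullet> (y - x)) + g y - g x}"

subsection \<open>Bregman distance\<close>

text \<open>Since \<open>f\<close> is a function on \<open>K\<close>, its derivative at a point is taken within the domain of
  \<open>f\<close>, so that boundary points of \<open>K\<close> are admitted; at interior points this is the ordinary
  derivative. The equivalence also says that the gradient is determined by \<open>f\<close>.\<close>

definition has_gradient ::
  "'a::euclidean_space set \<Rightarrow> ('a \<Rightarrow> ereal) \<Rightarrow> ('a \<Rightarrow> 'a) \<Rightarrow> bool" where
  "has_gradient K f gradf \<longleftrightarrow>
     (\<forall>x \<in> dom_subdiff K f. \<forall>v.
        ((\<lambda>y. real_of_ereal (f y)) has_derivative (\<lambda>h. v \<bullet> h)) (at x within edom K f)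
        \<longleftrightarrow> v = gradf x)"

definition strongly_convex1 ::
  "('a::euclidean_space \<Rightarrow> real) \<Rightarrow> 'a set \<Rightarrow> ('a \<Rightarrow> ereal) \<Rightarrow> ('a \<Rightarrow> 'a) \<Rightarrow> bool" where
  "strongly_convex1 N K f gradf \<longleftrightarrow>
     (\<forall>x \<in> edom K f. \<forall>y \<in> dom_subdiff K f.
        f x \<ge> f y + ereal (gradf y \<bullet> (x - y) + (1/2) * (N (x - y))\<^sup>2))"

definition bregman :: "('a::real_inner \<Rightarrow> ereal) \<Rightarrow> ('a \<Rightarrow> 'a) \<Rightarrow> 'a \<Rightarrow> 'a \<Rightarrow> ereal" where
  "bregman f gradf x y = f x - f y - ereal (gradf y \<bullet> (x - y))"

subsection \<open>Stochastic oracle\<close>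

text \<open>The indices \<open>\<xi>\<close> range over \<open>{1..M}\<close>, and \<open>Fo \<xi> z\<close> is the oracle value at \<open>z\<close>. The family
  \<open>Q\<close> of distributions is explicit because the algorithm samples from it.\<close>

definition lipschitz_in_mean_oracle ::
  "('a::euclidean_space \<Rightarrow> real) \<Rightarrow> nat \<Rightarrow> 'a set \<Rightarrow> ('a \<Rightarrow> 'a) \<Rightarrow> (nat \<Rightarrow> 'a \<Rightarrow> 'a)
    \<Rightarrow> ('a \<Rightarrow> 'a \<Rightarrow> nat pmf) \<Rightarrow> real \<Rightarrow> bool" where
  "lipschitz_in_mean_oracle N M domg F Fo Q Lbar \<longleftrightarrow>
     (\<forall>x\<in>domg. \<forall>y\<in>domg.
        set_pmf (Q x y) \<subseteq> {1..M} \<and>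
        (\<forall>z\<in>domg. F z = measure_pmf.expectation (Q x y) (\<lambda>\<xi>. Fo \<xi> z)) \<and>
        measure_pmf.expectation (Q x y) (\<lambda>\<xi>. (dual_norm N (Fo \<xi> x - Fo \<xi> y))\<^sup>2)
          \<le> Lbar\<^sup>2 * (N (x - y))\<^sup>2)"

subsection \<open>The algorithm\<close>

text \<open>The state at step \<open>s\<close> consists of $x_{s-1}$, $x_s$, $w_{s-1}$, $w_s$.\<close>

record 'a iterate =
  xprev :: 'a
  xcur :: 'a
  wprev :: 'a
  wcur :: 'a

definition mixed_gradient :: "('a::real_vector \<Rightarrow> 'a) \<Rightarrow> real \<Rightarrow> 'a iterate \<Rightarrow> 'a" where
  "mixed_gradient gradf \<gamma> z = \<gamma> *\<^sub>R gradf (xcur z) + (1 - \<gamma>) *\<^sub>R gradf (xprev z)"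

definition xbar ::
  "'a::real_inner set \<Rightarrow> ('a \<Rightarrow> ereal) \<Rightarrow> ('a \<Rightarrow> 'a) \<Rightarrow> real \<Rightarrow> 'a iterate \<Rightarrow> 'a" where
  "xbar K f gradf \<gamma> z = inv_into (dom_subdiff K f) gradf (mixed_gradient gradf \<gamma> z)"

text \<open>The minibatch \<open>B\<close> is a list, since indices are counted with multiplicity.\<close>

definition direction ::
  "('a::real_vector \<Rightarrow> 'a) \<Rightarrow> (nat \<Rightarrow> 'a \<Rightarrow> 'a) \<Rightarrow> nat list \<Rightarrow> 'a iterate \<Rightarrow> 'a" where
  "direction F Fo B z =
     (1 / real (length B)) *\<^sub>R
       (\<Sum>\<xi>\<leftarrow>B. F (wcur z) + Fo \<xi> (xcur z) - Fo \<xi> (wprev z))"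

definition prox_objective ::
  "('a::real_inner \<Rightarrow> ereal) \<Rightarrow> ('a \<Rightarrow> ereal) \<Rightarrow> ('a \<Rightarrow> 'a) \<Rightarrow> real \<Rightarrow> 'a \<Rightarrow> 'a \<Rightarrow> 'a \<Rightarrow> ereal" where
  "prox_objective g f gradf \<alpha> \<Delta> xb x =
     ereal \<alpha> * g x + ereal ((\<alpha> *\<^sub>R \<Delta>) \<bullet> x) + bregman f gradf x xb"

text \<open>The random outcome of step \<open>s\<close> is a pair of a minibatch and a coin, and \<open>\<omega> s\<close> denotes this
  pair; the iterates are deterministic functions of \<open>\<omega>\<close>.\<close>

primrec iterates ::
  "'a::real_inner set \<Rightarrow> ('a \<Rightarrow> ereal) \<Rightarrow> ('a \<Rightarrow> ereal) \<Rightarrow> ('a \<Rightarrow> 'a) \<Rightarrow> ('a \<Rightarrow> 'a) \<Rightarrow> (nat \<Rightarrow> 'a \<Rightarrow> 'a)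
    \<Rightarrow> real \<Rightarrow> real \<Rightarrow> 'a \<Rightarrow> (nat \<Rightarrow> nat list \<times> bool) \<Rightarrow> nat \<Rightarrow> 'a iterate" where
  "iterates K g f gradf F Fo \<alpha> \<gamma> x0 \<omega> 0 =
     \<lparr>xprev = x0, xcur = x0, wprev = x0, wcur = x0\<rparr>"
| "iterates K g f gradf F Fo \<alpha> \<gamma> x0 \<omega> (Suc s) =
     (let z = iterates K g f gradf F Fo \<alpha> \<gamma> x0 \<omega> s;
          (B, coin) = \<omega> s;
          xnext = arg_min_on (prox_objective g f gradf \<alpha> (direction F Fo B z) (xbar K f gradf \<gamma> z)) K
      in \<lparr>xprev = xcur z, xcur = xnext, wprev = wcur z,
          wcur = (if coin then xnext else xcur z)\<rparr>)"

text \<open>\<open>outcome_pmf Q p b zs S\<close> is the joint distribution of the outcomes of the steps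
  \<open>0, \<dots>, S - 1\<close> (later entries are dummies), where \<open>zs \<omega> s\<close> is the state in which step \<open>s\<close>
  samples.\<close>

primrec outcome_pmf ::
  "('a \<Rightarrow> 'a \<Rightarrow> nat pmf) \<Rightarrow> real \<Rightarrow> nat \<Rightarrow> ((nat \<Rightarrow> nat list \<times> bool) \<Rightarrow> nat \<Rightarrow> 'a iterate)
    \<Rightarrow> nat \<Rightarrow> (nat \<Rightarrow> nat list \<times> bool) pmf" where
  "outcome_pmf Q p b zs 0 = return_pmf (\<lambda>_. ([], False))"
| "outcome_pmf Q p b zs (Suc s) =
     bind_pmf (outcome_pmf Q p b zs s) (\<lambda>\<omega>.
       map_pmf (\<lambda>d. fun_upd \<omega> s d)
         (pair_pmf (replicate_pmf b (Q (xcur (zs \<omega> s)) (wprev (zs \<omega> s)))) (bernoulli_pmf p)))"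

end

theory Submission
  imports Defs
begin

text \<open>
Write \<open>D\<close> for the Bregman distance, \<open>x\<close>, \<open>x'\<close>, \<open>w\<close> for the current point, the previous point and the
current anchor, \<open>y\<close> for the next point, and \<open>a\<close>, \<open>a'\<close>, \<open>r\<close> for the squared distances of \<open>y\<close> from \<open>x\<close>, \<open>x'\<close>, \<open>w\<close>.
Optimality of the proximal step turns the weak Minty inequality into an energy inequality for
\<open>D(x\<^sup>*, y)\<close> (\<open>residual_minty\<close>, \<open>lyapunov_step\<close>). Its gain is \<open>\<gamma> D(y, x) + (1 - \<gamma>) D(y, x')\<close>. Its cost has
three parts: the inner product of \<open>F y - F w\<close> with \<open>y - x\<^sup>*\<close>, which telescopes in expectation because the oracle is
unbiased; a multiple of the squared residual, which \<open>residual_bound\<close> estimates by distances between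
iterates; and the pairing of the sampled oracle difference with \<open>y - x\<close>. A potential made of the energy, a
multiple of \<open>r\<close> and a multiple of \<open>a\<close> then decreases in expectation by at least the expected squared residual
divided by \<open>C = \<sigma>\<^sub>2 / \<sigma>\<^sub>1\<close> (\<open>potential_step\<close>), and summing over the steps gives the bound, even with
\<open>2 - \<gamma>\<close> in place of \<open>3 - \<gamma>\<close>.

Two points need an idea.

The norm is arbitrary, so averaging \<open>b\<close> independent samples does not by itself divide the second moment of
the dual norm by \<open>b\<close>. What does average is the conjugate of the Bregman distance
\<open>breg_conj x n = sup\<^sub>z (n \<bullet> (z - x) - D(z, x))\<close>. Strong convexity of \<open>f\<close> makes it smooth for
the dual norm (\<open>breg_conj_smooth\<close>), and a smooth convex function gains only the second moment of each sample when
samples are added one at a time (\<open>smooth_minibatch\<close>). The Fenchel inequality for this conjugate controls the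
pairing with \<open>y - x\<close>. For the dual norm itself, the conjugate based at an interior point of the domain
dominates, near zero, a multiple of the squared dual norm (\<open>breg_conj_lower\<close>, \<open>dual_minibatch_moment\<close>); the
loss is the square of the Lipschitz constant of the gradient, which the residual estimate contains anyway.

The next point depends on the anchor, so the expectation of \<open>r\<close> is not the mixture
\<open>p a + (1 - p) a'\<close>. But the coin that chose the anchor is independent of the previous step \<open>x - x'\<close>. The
triangle inequality bounds \<open>r\<close> by \<open>\<kappa>\<close> times this mixture plus a multiple of the squared length of \<open>x - x'\<close>,
with a coefficient that depends on the coin (\<open>dist_to_anchor\<close>) and whose mean is small enough to be paid by the
previous step (\<open>coin_weight_mean\<close>). The two step-size conditions make these costs fit under the gain (\<open>step_size_budget\<close>).
\<close>

section \<open>Norms and their duals\<close>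

locale finite_dim_norm =
  fixes N :: "'a::euclidean_space \<Rightarrow> real"
  assumes is_norm: "is_norm N"
begin

abbreviation dual :: "'a \<Rightarrow> real" where
  "dual \<equiv> dual_norm N"

lemma N_zero_iff: "N x = 0 \<longleftrightarrow> x = 0"
  using is_norm by (simp add: is_norm_def)

lemma N_triangle: "N (x + y) \<le> N x + N y"
  using is_norm by (simp add: is_norm_def)

lemma N_scaleR: "N (c *\<^sub>R x) = \<bar>c\<bar> * N x"
  using is_norm by (simp add: is_norm_def)

lemma N_minus: "N (- x) = N x"
  using N_scaleR[of "-1" x] by simp

lemma N_minus_commute: "N (x - y) = N (y - x)"
  using N_minus[of "x - y"] by simp

lemma N_nonneg: "0 \<le> N x"
  using N_triangle[of x "- x"] N_zero_iff[of 0] by (simp add: N_minus)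

lemma N_triangle_diff: "N (x - z) \<le> N (x - y) + N (y - z)"
  using N_triangle[of "x - y" "y - z"] by simp

lemma N_sum_le: "N (sum h A) \<le> (\<Sum>i\<in>A. N (h i))"
proof (induction A rule: infinite_finite_induct)
  case (insert i A)
  then show ?case using N_triangle[of "h i" "sum h A"] by simp
qed (use N_zero_iff[of 0] in simp_all)

lemma N_le_euclidean: "N x \<le> (\<Sum>e\<in>Basis. N e) * norm x"
proof -
  have "N x = N (\<Sum>e\<in>Basis. (x \<bullet> e) *\<^sub>R e)" by (simp add: euclidean_representation)
  also have "\<dots> \<le> (\<Sum>e\<in>Basis. \<bar>x \<bullet> e\<bar> * N e)"
    using N_sum_le[of "\<lambda>e. (x \<bullet> e) *\<^sub>R e" Basis] by (simp only: N_scaleR)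
  also have "\<dots> \<le> (\<Sum>e\<in>Basis. norm x * N e)"
    by (intro sum_mono mult_right_mono) (auto simp: Basis_le_norm N_nonneg)
  also have "\<dots> = (\<Sum>e\<in>Basis. N e) * norm x" by (simp add: sum_distrib_left sum_distrib_right mult.commute[of "norm x"])
  finally show ?thesis .
qed

lemma N_continuous: "continuous_on UNIV N"
proof -
  define C where "C = (\<Sum>e\<in>(Basis::'a set). N e)"
  have C0: "0 \<le> C" unfolding C_def by (intro sum_nonneg N_nonneg)
  have "C-lipschitz_on UNIV N"
  proof (rule lipschitz_onI)
    fix x y :: 'a
    have "\<bar>N x - N y\<bar> \<le> N (x - y)"
      using N_triangle[of "x - y" y] N_triangle[of "y - x" x] N_minus_commute[of x y] by simp
    also have "\<dots> \<le> C * norm (x - y)" unfolding C_def by (rule N_le_euclidean)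
    finally show "dist (N x) (N y) \<le> C * dist x y" by (simp add: dist_norm)
  qed (use C0 in simp)
  then show ?thesis by (rule lipschitz_on_continuous_on)
qed

text \<open>Compactness of the Euclidean unit sphere makes \<open>N\<close> comparable with the Euclidean norm.\<close>

lemma euclidean_le_norm: "\<exists>k>0. \<forall>x. k * norm x \<le> N x"
proof -
  obtain e0 :: 'a where e0: "e0 \<in> Basis" using nonempty_Basis by blast
  then have "e0 \<in> sphere 0 1" by simp
  then have "\<exists>x\<in>sphere 0 1. \<forall>y\<in>sphere 0 1. N x \<le> N y"
    by (intro continuous_attains_inf continuous_on_subset[OF N_continuous]) auto
  then obtain x0 where x0: "x0 \<in> sphere 0 1" and min: "\<forall>y\<in>sphere 0 1. N x0 \<le> N y" ..
  have "x0 \<noteq> 0" using x0 by (metis mem_sphere_0 norm_zero zero_neq_one)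
  then have pos: "N x0 > 0" using N_nonneg[of x0] N_zero_iff[of x0] by linarith
  have "N x0 * norm x \<le> N x" for x
  proof (cases "x = 0")
    case True
    then show ?thesis using N_zero_iff[of x] by simp
  next
    case False
    then have "(1 / norm x) *\<^sub>R x \<in> sphere 0 1" by simp
    then have "N x0 \<le> N ((1 / norm x) *\<^sub>R x)" using min by blast
    also have "\<dots> = N x / norm x" by (simp add: N_scaleR)
    finally show ?thesis using False by (simp add: pos_le_divide_eq)
  qed
  then show ?thesis using pos by blast
qed

lemma dual_bdd_above: "bdd_above ((\<lambda>x. w \<bullet> x) ` {x. N x \<le> 1})"
proof -
  obtain k where k: "k > 0" "\<And>x. k * norm x \<le> N x"
    using euclidean_le_norm by blast
  show ?thesis
  proof (rule bdd_aboveI2)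
    fix x assume "x \<in> {x. N x \<le> 1}"
    then have "norm x \<le> 1 / k" using k(2)[of x] k(1) by (simp add: field_simps)
    moreover have "w \<bullet> x \<le> norm w * norm x" by (rule norm_cauchy_schwarz)
    ultimately show "w \<bullet> x \<le> norm w * (1 / k)"
      by (meson mult_left_mono norm_ge_zero order_trans)
  qed
qed

lemma inner_le_dual_unit: "N x \<le> 1 \<Longrightarrow> w \<bullet> x \<le> dual w"
  unfolding dual_norm_def by (rule cSUP_upper[OF _ dual_bdd_above]) simp

lemma dual_le: "(\<And>x. N x \<le> 1 \<Longrightarrow> w \<bullet> x \<le> B) \<Longrightarrow> dual w \<le> B"
  unfolding dual_norm_def
proof (rule cSUP_least)
  have "N 0 \<le> 1" using N_zero_iff[of 0] by simp
  then show "{x. N x \<le> 1} \<noteq> {}" by blast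
qed simp

lemma dual_nonneg: "0 \<le> dual w"
  using inner_le_dual_unit[of 0 w] N_zero_iff[of 0] by simp

lemma inner_le_dual: "w \<bullet> x \<le> dual w * N x"
proof (cases "x = 0")
  case False
  then have pos: "N x > 0" using N_nonneg[of x] N_zero_iff[of x] by linarith
  have "w \<bullet> ((1 / N x) *\<^sub>R x) \<le> dual w"
    by (rule inner_le_dual_unit) (use pos in \<open>simp add: N_scaleR\<close>)
  then show ?thesis using pos by (simp add: field_simps)
qed (use N_zero_iff[of 0] in simp)

lemma dual_triangle: "dual (v + w) \<le> dual v + dual w"
  by (rule dual_le) (simp add: inner_add_left add_mono inner_le_dual_unit)

lemma dual_scaleR: "dual (c *\<^sub>R w) = \<bar>c\<bar> * dual w"
proof -
  have le: "dual (c *\<^sub>R w) \<le> \<bar>c\<bar> * dual w" for c w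
  proof (rule dual_le)
    fix x assume x: "N x \<le> 1"
    have "(c *\<^sub>R w) \<bullet> x = \<bar>c\<bar> * (w \<bullet> (sgn c *\<^sub>R x))"
      by (simp add: abs_mult_sgn mult.assoc[symmetric])
    also have "\<dots> \<le> \<bar>c\<bar> * dual w"
      by (intro mult_left_mono inner_le_dual_unit)
        (use x in \<open>auto simp: N_scaleR sgn_if N_nonneg\<close>)
    finally show "(c *\<^sub>R w) \<bullet> x \<le> \<bar>c\<bar> * dual w" .
  qed
  show ?thesis
  proof (cases "c = 0")
    case True
    then show ?thesis using le[of 0 w] dual_nonneg[of "0 *\<^sub>R w"] by simp
  next
    case False
    then show ?thesis using le[of c w] le[of "1 / c" "c *\<^sub>R w"] by (simp add: field_simps)
  qed
qed

lemma dual_minus: "dual (- w) = dual w"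
  using dual_scaleR[of "-1" w] by simp

lemma young: "w \<bullet> x \<le> (dual w)\<^sup>2 / 2 + (N x)\<^sup>2 / 2"
proof -
  have "0 \<le> (dual w - N x)\<^sup>2" by simp
  then show ?thesis using inner_le_dual[of w x] by (simp add: power2_diff)
qed

text \<open>Convexity of the squared dual norm, with its weights kept: it is applied to the mixed gradient,
  whose weights \<open>\<gamma>\<close> and \<open>1 - \<gamma>\<close> must match those of the energy gain.\<close>

lemma dual_convex_sq:
  assumes "0 \<le> t" "t \<le> 1"
  shows "(dual (t *\<^sub>R v + (1 - t) *\<^sub>R w))\<^sup>2 \<le> t * (dual v)\<^sup>2 + (1 - t) * (dual w)\<^sup>2"
proof -
  have "dual (t *\<^sub>R v + (1 - t) *\<^sub>R w) \<le> t * dual v + (1 - t) * dual w"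
    using dual_triangle[of "t *\<^sub>R v" "(1 - t) *\<^sub>R w"] assms by (simp add: dual_scaleR)
  then have "(dual (t *\<^sub>R v + (1 - t) *\<^sub>R w))\<^sup>2 \<le> (t * dual v + (1 - t) * dual w)\<^sup>2"
    by (intro power_mono dual_nonneg)
  also have "\<dots> = t * (dual v)\<^sup>2 + (1 - t) * (dual w)\<^sup>2 - t * (1 - t) * (dual v - dual w)\<^sup>2"
    by (simp add: power2_eq_square algebra_simps)
  also have "\<dots> \<le> t * (dual v)\<^sup>2 + (1 - t) * (dual w)\<^sup>2" using assms by simp
  finally show ?thesis .
qed

lemma dual_sq_sum3:
  "(dual (x + y + z))\<^sup>2 \<le> 4 * (dual x)\<^sup>2 + 4 * (dual y)\<^sup>2 + 2 * (dual z)\<^sup>2"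
proof -
  have half: "(dual (v + w))\<^sup>2 \<le> 2 * (dual v)\<^sup>2 + 2 * (dual w)\<^sup>2" for v w
    using dual_convex_sq[of "1/2" "2 *\<^sub>R v" "2 *\<^sub>R w"] by (simp add: dual_scaleR power_mult_distrib)
  show ?thesis using half[of "x + y" z] half[of x y] by linarith
qed

end

section \<open>Minimisation of lower semicontinuous functions\<close>

text \<open>If the values stayed at most \<open>t\<close> along a sequence but not at its limit, lower semicontinuity of
  \<open>f\<close> and continuity of \<open>q\<close> would push them above \<open>t\<close> near the limit.\<close>

lemma lsc_sublevel_closed:
  fixes f :: "'a::metric_space \<Rightarrow> ereal" and q :: "'a \<Rightarrow> real"
  assumes K: "closed K" and lsc: "\<And>x. x \<in> K \<Longrightarrow> f x \<le> Liminf (at x within K) f"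
    and q: "continuous_on K q"
  shows "closed {x\<in>K. f x + ereal (q x) \<le> t}"
  unfolding closed_limpt islimpt_sequential
proof (intro allI impI, elim exE conjE)
  fix x and xs :: "nat \<Rightarrow> 'a"
  assume xs: "\<forall>n. xs n \<in> {x \<in> K. f x + ereal (q x) \<le> t} - {x}" and lim: "xs \<longlonglongrightarrow> x"
  have xK: "x \<in> K" using K xs lim closed_sequentially[of K xs x] by auto
  have at: "filterlim xs (at x within K) sequentially"
    using xs lim unfolding filterlim_at by (auto intro: always_eventually)
  have qlim: "(\<lambda>n. q (xs n)) \<longlonglongrightarrow> q x"
    using q xK at unfolding continuous_on_def by (metis filterlim_compose)
  have "f x + ereal (q x) \<le> t"
  proof (rule ccontr)
    assume "\<not> f x + ereal (q x) \<le> t"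
    then have "t - ereal (q x) < f x"
      by (cases t; cases "f x") auto
    then obtain r where r: "t - ereal (q x) < ereal r" "ereal r < f x"
      by (metis ereal_dense2)
    have "\<forall>\<^sub>F y in at x within K. ereal r < f y"
      using lsc[OF xK] r(2) le_Liminf_iff by blast
    then have ev: "\<forall>\<^sub>F n in sequentially. ereal r < f (xs n)"
      using at by (rule eventually_compose_filterlim)
    have nt: "t \<noteq> \<infinity>" using r by auto
    show False
    proof (cases t)
      case (real t')
      then have "t' - r < q x" using r(1) by simp
      then have "\<forall>\<^sub>F n in sequentially. t' - r < q (xs n)"
        using qlim by (simp add: order_tendsto_iff)
      with ev have "\<forall>\<^sub>F n in sequentially. False"
      proof eventually_elim
        case (elim n)
        have "f (xs n) + ereal (q (xs n)) \<le> t" using xs by auto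
        with elim real show ?case by (cases "f (xs n)") auto
      qed
      then show False by simp
    next
      case MInf
      from ev have "\<forall>\<^sub>F n in sequentially. False"
      proof eventually_elim
        case (elim n)
        have "f (xs n) + ereal (q (xs n)) \<le> t" using xs by auto
        with elim MInf show ?case by (cases "f (xs n)") auto
      qed
      then show False by simp
    qed (use nt in simp)
  qed
  with xK show "x \<in> {x \<in> K. f x + ereal (q x) \<le> t}" by simp
qed

text \<open>The sublevel sets at the values taken on \<open>K\<close> form a chain of nonempty closed sets, one of them
  bounded, so they have a common point.\<close>

lemma lsc_attains_min:
  fixes f :: "'a::heine_borel \<Rightarrow> ereal" and q :: "'a \<Rightarrow> real"
  assumes K: "closed K" and lsc: "\<And>x. x \<in> K \<Longrightarrow> f x \<le> Liminf (at x within K) f"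
    and q: "continuous_on K q"
    and c: "c \<in> K" "bounded {x\<in>K. f x + ereal (q x) \<le> f c + ereal (q c)}"
  obtains z where "z \<in> K" "\<And>y. y \<in> K \<Longrightarrow> f z + ereal (q z) \<le> f y + ereal (q y)"
proof -
  define lev where "lev y = {x\<in>K. f x + ereal (q x) \<le> f y + ereal (q y)}" for y
  have "\<Inter>(lev ` K) \<noteq> {}"
  proof (rule bounded_closed_chain[of "lev c"])
    show "closed T" if "T \<in> lev ` K" for T
      using that lsc_sublevel_closed[OF K lsc q] by (auto simp: lev_def)
    show "S \<subseteq> T \<or> T \<subseteq> S" if ST: "S \<in> lev ` K \<and> T \<in> lev ` K" for S T
    proof -
      obtain y y' where y: "S = lev y" "T = lev y'" using ST by blast
      consider "f y + ereal (q y) \<le> f y' + ereal (q y')" | "f y' + ereal (q y') \<le> f y + ereal (q y)"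
        by (rule linear[THEN disjE])
      then show ?thesis by cases (auto simp: y lev_def intro: order_trans)
    qed
  qed (use c in \<open>auto simp: lev_def\<close>)
  then obtain z where z: "\<And>y. y \<in> K \<Longrightarrow> z \<in> lev y" by blast
  then have "z \<in> K" using c(1) by (auto simp: lev_def)
  with z that show thesis by (auto simp: lev_def)
qed

text \<open>Moving from the minimiser \<open>x\<close> towards \<open>y\<close> by a fraction \<open>t\<close> lowers the convex part by at
  least \<open>t (h x - h y)\<close> and changes the smooth part to first order by \<open>t v \<bullet> (y - x)\<close>.\<close>

lemma first_order_condition:
  fixes h :: "'a::euclidean_space \<Rightarrow> ereal" and q :: "'a \<Rightarrow> real"
  assumes K: "convex K"
    and h_minf: "\<And>y. y \<in> K \<Longrightarrow> h y \<noteq> -\<infinity>"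
    and h_conv: "\<And>x y t. x \<in> K \<Longrightarrow> y \<in> K \<Longrightarrow> t \<in> {0<..<1} \<Longrightarrow>
        h ((1 - t) *\<^sub>R x + t *\<^sub>R y) \<le> ereal (1 - t) * h x + ereal t * h y"
    and q: "(q has_derivative (\<lambda>d. v \<bullet> d)) (at x within T)" and T: "edom K h \<subseteq> T"
    and x: "x \<in> edom K h"
    and min: "\<And>y. y \<in> edom K h \<Longrightarrow> h x + ereal (q x) \<le> h y + ereal (q y)"
    and y: "y \<in> K"
  shows "h x + ereal ((- v) \<bullet> (y - x)) \<le> h y"
proof (cases "h y = \<infinity>")
  case False
  have xK: "x \<in> K" using x by (simp add: edom_def)
  define hx hy where "hx = real_of_ereal (h x)" and "hy = real_of_ereal (h y)"
  have hx: "h x = ereal hx" unfolding hx_def using x h_minf by (cases "h x") (auto simp: edom_def)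
  have hy: "h y = ereal hy" unfolding hy_def using y h_minf False by (cases "h y") auto
  define pt where "pt t = (1 - t) *\<^sub>R x + t *\<^sub>R y" for t
  have pt_x: "pt t - x = t *\<^sub>R (y - x)" for t by (simp add: pt_def algebra_simps)
  have drop: "hx - hy \<le> (q (pt t) - q x) / t" and ptT: "pt t \<in> T" if t: "t \<in> {0<..<1}" for t
  proof -
    have ptK: "pt t \<in> K" unfolding pt_def using K xK y t by (auto intro!: convexD)
    have le: "h (pt t) \<le> ereal ((1 - t) * hx + t * hy)"
      using h_conv[OF xK y t] hx hy by (simp add: pt_def)
    then have dom: "pt t \<in> edom K h" using ptK by (auto simp: edom_def intro: le_less_trans)
    then show "pt t \<in> T" using T by blast
    obtain r where r: "h (pt t) = ereal r" using dom h_minf by (cases "h (pt t)") (auto simp: edom_def)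
    have "hx + q x \<le> r + q (pt t)" using min[OF dom] by (simp add: hx r)
    moreover have "r \<le> (1 - t) * hx + t * hy" using le r by simp
    ultimately have "t * (hx - hy) \<le> q (pt t) - q x" by (simp add: algebra_simps)
    then show "hx - hy \<le> (q (pt t) - q x) / t" using t by (simp add: field_simps)
  qed
  have "pt ` {0..<1} \<subseteq> T" using ptT T x by (fastforce simp: pt_def less_eq_real_def)
  then have "(q has_derivative (\<lambda>d. v \<bullet> d)) (at (pt 0) within pt ` {0..<1})"
    using q by (auto simp: pt_def intro: has_derivative_subset)
  moreover have "(pt has_derivative (\<lambda>t. t *\<^sub>R (y - x))) (at 0 within {0..<1})"
    unfolding pt_def by (auto intro!: derivative_eq_intros simp: algebra_simps)
  ultimately have "((\<lambda>t. q (pt t)) has_derivative (\<lambda>t. v \<bullet> (t *\<^sub>R (y - x)))) (at 0 within {0..<1})"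
    by (rule has_derivative_in_compose[rotated])
  then have "((\<lambda>t. q (pt t)) has_real_derivative v \<bullet> (y - x)) (at 0 within {0..<1})"
    unfolding has_field_derivative_def by (simp add: mult_commute_abs)
  then have lim: "((\<lambda>t. (q (pt t) - q x) / t) \<longlongrightarrow> v \<bullet> (y - x)) (at 0 within {0..<1})"
    by (simp add: has_field_derivative_iff pt_def)
  have "hx - hy \<le> v \<bullet> (y - x)"
  proof (rule tendsto_lowerbound[OF lim])
    show "\<forall>\<^sub>F t in at 0 within {0..<1}. hx - hy \<le> (q (pt t) - q x) / t"
      using drop by (auto simp: eventually_at_filter)
    show "at 0 within {0..<1::real} \<noteq> bot"
      by (simp add: trivial_limit_within islimpt_Ico)
  qed
  then show ?thesis by (simp add: hx hy)
qed simp

section \<open>Mirror maps and the conjugate of the Bregman distance\<close>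

locale mirror_map = finite_dim_norm N for N :: "'a::euclidean_space \<Rightarrow> real" +
  fixes K :: "'a set" and f :: "'a \<Rightarrow> ereal" and gradf :: "'a \<Rightarrow> 'a"
  assumes closed_K: "closed K" and convex_K: "convex K"
    and f_proper: "proper_convex_lsc K f"
    and gradient: "has_gradient K f gradf"
    and strong: "strongly_convex1 N K f gradf"
begin

abbreviation domf :: "'a set" where
  "domf \<equiv> edom K f"

abbreviation doms :: "'a set" where
  "doms \<equiv> dom_subdiff K f"

definition fr :: "'a \<Rightarrow> real" where
  "fr x = real_of_ereal (f x)"

definition breg :: "'a \<Rightarrow> 'a \<Rightarrow> real" where
  "breg x y = fr x - fr y - gradf y \<bullet> (x - y)"

lemma domf_K: "x \<in> domf \<Longrightarrow> x \<in> K"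
  by (simp add: edom_def)

lemma doms_domf: "x \<in> doms \<Longrightarrow> x \<in> domf"
  by (simp add: dom_subdiff_def)

lemma f_not_minf: "x \<in> K \<Longrightarrow> f x \<noteq> -\<infinity>"
  using f_proper by (simp add: proper_convex_lsc_def)

lemma f_finite: "x \<in> domf \<Longrightarrow> f x = ereal (fr x)"
  using f_not_minf[of x] by (cases "f x") (auto simp: edom_def fr_def)

lemma f_convex:
  "x \<in> K \<Longrightarrow> y \<in> K \<Longrightarrow> t \<in> {0<..<1} \<Longrightarrow>
    f ((1 - t) *\<^sub>R x + t *\<^sub>R y) \<le> ereal (1 - t) * f x + ereal t * f y"
  using f_proper by (simp add: proper_convex_lsc_def)

lemma domf_convex: "convex domf"
  unfolding convex_alt
proof (intro ballI allI impI)
  fix x y and t :: real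
  assume xy: "x \<in> domf" "y \<in> domf" and t: "0 \<le> t \<and> t \<le> 1"
  show "(1 - t) *\<^sub>R x + t *\<^sub>R y \<in> domf"
  proof (cases "t = 0 \<or> t = 1")
    case False
    then have t': "t \<in> {0<..<1}" using t by auto
    have "(1 - t) *\<^sub>R x + t *\<^sub>R y \<in> K"
      using convex_K xy t by (auto simp: convex_alt edom_def)
    moreover have "f ((1 - t) *\<^sub>R x + t *\<^sub>R y) \<le> ereal ((1 - t) * fr x + t * fr y)"
      using f_convex[OF domf_K[OF xy(1)] domf_K[OF xy(2)] t'] xy by (simp add: f_finite)
    ultimately show ?thesis by (auto simp: edom_def intro: le_less_trans)
  qed (use xy in auto)
qed

lemma breg_ge: "x \<in> domf \<Longrightarrow> y \<in> doms \<Longrightarrow> (N (x - y))\<^sup>2 / 2 \<le> breg x y"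
proof -
  assume xy: "x \<in> domf" "y \<in> doms"
  then have "f y + ereal (gradf y \<bullet> (x - y) + (1/2) * (N (x - y))\<^sup>2) \<le> f x"
    using strong by (simp add: strongly_convex1_def)
  then show ?thesis using xy by (simp add: f_finite doms_domf breg_def)
qed

lemma breg_nonneg: "x \<in> domf \<Longrightarrow> y \<in> doms \<Longrightarrow> 0 \<le> breg x y"
  using breg_ge[of x y] zero_le_power2[of "N (x - y)"] by linarith

lemma breg_three_point: "breg x y = breg x z + breg z y + (gradf z - gradf y) \<bullet> (x - z)"
  by (simp add: breg_def inner_diff_left inner_diff_right)

lemma breg_self: "breg x x = 0"
  by (simp add: breg_def)

lemma bregman_eq_breg: "x \<in> domf \<Longrightarrow> y \<in> domf \<Longrightarrow> bregman f gradf x y = ereal (breg x y)"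
  by (simp add: bregman_def breg_def f_finite)

lemma gradient_within: "x \<in> doms \<Longrightarrow> (fr has_derivative (\<lambda>d. gradf x \<bullet> d)) (at x within domf)"
  using gradient unfolding has_gradient_def fr_def by blast

lemma subgradient_in_doms:
  assumes x: "x \<in> domf" and v: "\<And>y. y \<in> domf \<Longrightarrow> fr x + v \<bullet> (y - x) \<le> fr y"
  shows "x \<in> doms"
proof -
  have "f x + indicator_ext K x + ereal (v \<bullet> (y - x)) \<le> f y + indicator_ext K y" for y
  proof (cases "y \<in> domf")
    case True
    then show ?thesis using x v[OF True] by (simp add: f_finite indicator_ext_def domf_K)
  next
    case False
    then have "f y = \<infinity> \<or> indicator_ext K y = \<infinity>"
      by (auto simp: edom_def indicator_ext_def)
    then have "f y + indicator_ext K y = \<infinity>" by auto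
    then show ?thesis by (simp only: ereal_less_eq(1))
  qed
  then have "v \<in> subdifferential (\<lambda>z. f z + indicator_ext K z) x"
    using x by (simp add: subdifferential_def f_finite indicator_ext_def domf_K)
  then show ?thesis using x by (auto simp: dom_subdiff_def)
qed

text \<open>At a boundary point of the domain the subgradient \<open>v\<close> need not be the gradient, but the
  two differ by an element of the normal cone.\<close>

lemma subgradient_normal_cone:
  assumes x: "x \<in> domf" and v: "\<And>y. y \<in> domf \<Longrightarrow> fr x + v \<bullet> (y - x) \<le> fr y"
    and y: "y \<in> domf"
  shows "v \<bullet> (y - x) \<le> gradf x \<bullet> (y - x)"
proof -
  have "(0::ereal) + ereal ((- (gradf x - v)) \<bullet> (y - x)) \<le> 0"
  proof (rule first_order_condition[where h = "\<lambda>_. 0" and K = domf and T = domf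
        and q = "\<lambda>z. fr z - v \<bullet> z"])
    show "((\<lambda>z. fr z - v \<bullet> z) has_derivative (\<bullet>) (gradf x - v)) (at x within domf)"
      by (auto intro!: derivative_eq_intros gradient_within subgradient_in_doms x v
          simp: inner_diff_left)
    show "0 + ereal (fr x - v \<bullet> x) \<le> 0 + ereal (fr y - v \<bullet> y)" if "y \<in> edom domf (\<lambda>_. 0)" for y
      using v[of y] that by (simp add: edom_def inner_diff_right)
  qed (use domf_convex x y in \<open>auto simp: edom_def\<close>)
  then show ?thesis by (simp add: inner_diff_left)
qed

text \<open>Strong convexity is stated with the gradient. Moving along the domain, the gradient increases at
  least as fast as any subgradient, so the quadratic growth carries over to subgradients.\<close>

lemma subgradient_growth:
  assumes x: "x \<in> domf" and v: "\<And>y. y \<in> domf \<Longrightarrow> fr x + v \<bullet> (y - x) \<le> fr y"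
    and y: "y \<in> domf"
  shows "fr x + v \<bullet> (y - x) + (N (y - x))\<^sup>2 / 2 \<le> fr y"
  using subgradient_normal_cone[OF x v y] breg_ge[OF y subgradient_in_doms[OF x v]]
  by (simp add: breg_def)

text \<open>Quadratic growth of \<open>f\<close> around \<open>y\<close> beats any affine lower bound of the perturbation, so sublevel
  sets are bounded. Both a linear tilt (for the conjugate) and a quadratic penalty (to reach interior
  points) are perturbations of this kind.\<close>

lemma perturbed_minimiser:
  assumes y: "y \<in> doms" and q: "continuous_on K q" and low: "\<And>x. x \<in> K \<Longrightarrow> e0 + e \<bullet> x \<le> q x"
  obtains z where "z \<in> domf" "\<And>x. x \<in> domf \<Longrightarrow> fr z + q z \<le> fr x + q x"
proof -
  obtain k where k: "k > 0" "\<And>x. k * norm x \<le> N x" using euclidean_le_norm by blast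
  define C B where "C = \<bar>q y - e0 - e \<bullet> y\<bar>" and "B = norm (e + gradf y)"
  have yd: "y \<in> domf" by (rule doms_domf[OF y])
  define R where "R = max 1 (2 * (C + B) / k\<^sup>2)"
  have "norm (x - y) \<le> R" if x: "x \<in> K" "f x + ereal (q x) \<le> f y + ereal (q y)" for x
  proof -
    have xd: "x \<in> domf" using x f_finite[OF yd] by (cases "f x") (auto simp: edom_def)
    define t where "t = norm (x - y)"
    have "(k * t)\<^sup>2 \<le> (N (x - y))\<^sup>2" unfolding t_def using k by (intro power_mono) auto
    moreover have "fr x + q x \<le> fr y + q y" using x xd yd by (simp add: f_finite)
    moreover have "e0 + e \<bullet> x \<le> q x" by (rule low[OF x(1)])
    moreover have "- ((e + gradf y) \<bullet> (x - y)) \<le> B * t"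
      using norm_cauchy_schwarz[of "- (e + gradf y)" "x - y"]
      unfolding B_def t_def norm_minus_cancel inner_minus_left .
    moreover have "q y - e0 - e \<bullet> y \<le> C" by (simp add: C_def)
    ultimately have main: "(k * t)\<^sup>2 / 2 \<le> C + B * t"
      using breg_ge[OF xd y] by (simp add: breg_def inner_diff_right inner_add_left)
    show "norm (x - y) \<le> R"
    proof (cases "t \<le> 1")
      case False
      have "C \<le> C * t" using False mult_left_mono[of 1 t C] by (simp add: C_def)
      then have "(k\<^sup>2 * t) * t \<le> (2 * (C + B)) * t"
        using main by (simp add: power2_eq_square algebra_simps)
      then have "k\<^sup>2 * t \<le> 2 * (C + B)" using False by simp
      then have "t \<le> 2 * (C + B) / k\<^sup>2" using k(1) by (simp add: field_simps)
      then show ?thesis by (simp add: R_def t_def)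
    qed (simp add: R_def t_def)
  qed
  then have "bounded {x \<in> K. f x + ereal (q x) \<le> f y + ereal (q y)}"
    using bounded_subset[OF bounded_cball[of y R]]
    by (auto simp: dist_norm norm_minus_commute subset_iff)
  moreover have "\<And>x. x \<in> K \<Longrightarrow> f x \<le> Liminf (at x within K) f"
    using f_proper by (simp add: proper_convex_lsc_def)
  ultimately obtain z where z: "z \<in> K" "\<And>x. x \<in> K \<Longrightarrow> f z + ereal (q z) \<le> f x + ereal (q x)"
    using lsc_attains_min[OF closed_K _ q domf_K[OF yd]] by blast
  have zd: "z \<in> domf" using z(1) z(2)[OF domf_K[OF yd]] f_finite[OF yd]
    by (cases "f z") (auto simp: edom_def)
  moreover have "fr z + q z \<le> fr x + q x" if "x \<in> domf" for x
    using z(2)[OF domf_K[OF that]] zd that by (simp add: f_finite)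
  ultimately show thesis using that by blast
qed

text \<open>This is the convex conjugate of \<open>f\<close>, restricted to its domain, recentred at the point \<open>gradf y\<close>
  so that value and slope vanish there.\<close>

definition breg_conj :: "'a \<Rightarrow> 'a \<Rightarrow> real" where
  "breg_conj y n = (SUP x\<in>domf. n \<bullet> (x - y) - breg x y)"

lemma breg_conj_attained:
  assumes y: "y \<in> doms"
  obtains z where "z \<in> doms"
    "\<And>x. x \<in> domf \<Longrightarrow> fr z + (gradf y + n) \<bullet> (x - z) \<le> fr x"
    "\<And>x. x \<in> domf \<Longrightarrow> n \<bullet> (x - y) - breg x y + (N (x - z))\<^sup>2 / 2 \<le> n \<bullet> (z - y) - breg z y"
    "breg_conj y n = n \<bullet> (z - y) - breg z y"
proof -
  define v where "v = gradf y + n"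
  obtain z where z: "z \<in> domf" "\<And>x. x \<in> domf \<Longrightarrow> fr z + - (v \<bullet> z) \<le> fr x + - (v \<bullet> x)"
  proof (rule perturbed_minimiser[OF y, of "\<lambda>x. - (v \<bullet> x)" 0 "- v"])
    show "continuous_on K (\<lambda>x. - (v \<bullet> x))" by (intro continuous_intros)
  qed auto
  have sub: "fr z + v \<bullet> (x - z) \<le> fr x" if "x \<in> domf" for x
    using z(2)[OF that] by (simp add: inner_diff_right)
  have grow: "n \<bullet> (x - y) - breg x y + (N (x - z))\<^sup>2 / 2 \<le> n \<bullet> (z - y) - breg z y" if "x \<in> domf" for x
    using subgradient_growth[OF z(1) sub that]
    by (simp add: breg_def v_def inner_diff_right inner_add_left)
  have "n \<bullet> (x - y) - breg x y \<le> n \<bullet> (z - y) - breg z y" if "x \<in> domf" for x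
    using grow[OF that] zero_le_power2[of "N (x - z)"] by linarith
  then have "breg_conj y n = n \<bullet> (z - y) - breg z y"
    unfolding breg_conj_def using z(1) by (intro cSup_eq_maximum) auto
  then show thesis
    using that[OF subgradient_in_doms[OF z(1) sub]] sub grow by (auto simp: v_def)
qed

lemma breg_conj_fenchel:
  assumes "y \<in> doms" "x \<in> domf"
  shows "n \<bullet> (x - y) \<le> breg x y + breg_conj y n"
proof -
  obtain z where z: "z \<in> doms"
    "\<And>x. x \<in> domf \<Longrightarrow> fr z + (gradf y + n) \<bullet> (x - z) \<le> fr x"
    "\<And>x. x \<in> domf \<Longrightarrow> n \<bullet> (x - y) - breg x y + (N (x - z))\<^sup>2 / 2 \<le> n \<bullet> (z - y) - breg z y"
    "breg_conj y n = n \<bullet> (z - y) - breg z y"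
    by (rule breg_conj_attained[OF assms(1), of n]) (rule that)
  show ?thesis using z(3)[OF assms(2)] z(4) zero_le_power2[of "N (x - z)"] by linarith
qed

lemma breg_conj_le:
  assumes "y \<in> doms"
  shows "breg_conj y n \<le> (dual n)\<^sup>2 / 2"
proof -
  obtain z where z: "z \<in> doms"
    "\<And>x. x \<in> domf \<Longrightarrow> fr z + (gradf y + n) \<bullet> (x - z) \<le> fr x"
    "\<And>x. x \<in> domf \<Longrightarrow> n \<bullet> (x - y) - breg x y + (N (x - z))\<^sup>2 / 2 \<le> n \<bullet> (z - y) - breg z y"
    "breg_conj y n = n \<bullet> (z - y) - breg z y"
    by (rule breg_conj_attained[OF assms, of n]) (rule that)
  show ?thesis
    using young[of n "z - y"] breg_ge[OF doms_domf[OF z(1)] assms] z(4) by linarith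
qed

text \<open>The slope is the displacement \<open>z - y\<close> of the maximiser. The lower bound is the value of the
  tilted objective at \<open>z\<close>; the upper bound holds because the tilted objective drops quadratically away
  from \<open>z\<close>. This is the duality of strong convexity and smoothness.\<close>

lemma breg_conj_smooth:
  assumes y: "y \<in> doms"
  shows "\<exists>e. \<forall>\<delta>. breg_conj y n + e \<bullet> \<delta> \<le> breg_conj y (n + \<delta>) \<and>
    breg_conj y (n + \<delta>) \<le> breg_conj y n + e \<bullet> \<delta> + (dual \<delta>)\<^sup>2 / 2"
proof -
  obtain z where z: "z \<in> doms"
    and "\<And>x. x \<in> domf \<Longrightarrow> fr z + (gradf y + n) \<bullet> (x - z) \<le> fr x"
    and grow: "\<And>x. x \<in> domf \<Longrightarrow> n \<bullet> (x - y) - breg x y + (N (x - z))\<^sup>2 / 2 \<le> n \<bullet> (z - y) - breg z y"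
    and val: "breg_conj y n = n \<bullet> (z - y) - breg z y"
    by (rule breg_conj_attained[OF y, of n]) (rule that)
  have "breg_conj y n + (z - y) \<bullet> \<delta> \<le> breg_conj y (n + \<delta>)" for \<delta>
    using breg_conj_fenchel[OF y doms_domf[OF z], of "n + \<delta>"] val
    by (simp add: inner_add_left inner_commute[of "z - y" \<delta>])
  moreover have "breg_conj y (n + \<delta>) \<le> breg_conj y n + (z - y) \<bullet> \<delta> + (dual \<delta>)\<^sup>2 / 2" for \<delta>
  proof -
    obtain x where x: "x \<in> doms" "breg_conj y (n + \<delta>) = (n + \<delta>) \<bullet> (x - y) - breg x y"
      by (rule breg_conj_attained[OF y, of "n + \<delta>"]) (rule that)
    have "(n + \<delta>) \<bullet> (x - y) = n \<bullet> (x - y) + (z - y) \<bullet> \<delta> + \<delta> \<bullet> (x - z)"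
      by (simp add: inner_add_left inner_diff_right inner_commute[of "z - y" \<delta>])
    then show ?thesis using x(2) grow[OF doms_domf[OF x(1)]] young[of \<delta> "x - z"] val by linarith
  qed
  ultimately show ?thesis by blast
qed

text \<open>If the domain lay in a hyperplane, adding a normal vector to a gradient would give another
  derivative within the domain, against the uniqueness of the gradient.\<close>

lemma domf_interior_nonempty:
  assumes y: "y \<in> doms"
  shows "interior domf \<noteq> {}"
proof
  assume "interior domf = {}"
  then obtain a b where a: "a \<noteq> 0" "domf \<subseteq> {x. a \<bullet> x = b}"
    using empty_interior_subset_hyperplane[OF domf_convex] by blast
  have "(fr has_derivative (\<lambda>d. (gradf y + a) \<bullet> d)) (at y within domf)"
  proof -
    have "((\<lambda>x. fr x + a \<bullet> x) has_derivative (\<lambda>d. (gradf y + a) \<bullet> d)) (at y within domf)"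
      by (auto intro!: derivative_eq_intros gradient_within y simp: inner_add_left)
    then have "((\<lambda>x. fr x + b) has_derivative (\<lambda>d. (gradf y + a) \<bullet> d)) (at y within domf)"
      by (rule has_derivative_transform[rotated 2]) (use a doms_domf[OF y] in auto)
    then have "((\<lambda>x. (fr x + b) + - b) has_derivative (\<lambda>d. (gradf y + a) \<bullet> d + 0)) (at y within domf)"
      by (rule has_derivative_add) simp
    then show ?thesis by simp
  qed
  then have "gradf y + a = gradf y"
    using gradient y unfolding has_gradient_def fr_def[abs_def] by blast
  then show False using a by simp
qed

text \<open>A minimiser of \<open>f\<close> plus a steep quadratic penalty around an interior point has a subgradient, by
  the first-order condition, and stays within a prescribed distance of that point.\<close>

lemma doms_meets_interior:
  assumes y: "y \<in> doms"
  obtains z where "z \<in> doms" "z \<in> interior domf"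
proof -
  obtain c where "c \<in> interior domf" using domf_interior_nonempty[OF y] by blast
  then obtain r where r: "r > 0" "ball c r \<subseteq> domf" using mem_interior by blast
  then have c: "c \<in> domf" by auto
  define B where "B = \<bar>fr c - fr y - gradf y \<bullet> (c - y)\<bar>"
  \<comment> \<open>steep enough that the penalty at distance \<open>r\<close> exceeds what the affine minorant of \<open>f\<close> at \<open>y\<close> allows\<close>
  define k where "k = (B + norm (gradf y) * r + 1) / r\<^sup>2"
  have k0: "k > 0" unfolding k_def using r(1) by (simp add: B_def add_nonneg_pos)
  have kr: "k * r\<^sup>2 = B + norm (gradf y) * r + 1" unfolding k_def using r(1) by simp
  define q where "q x = k * ((x - c) \<bullet> (x - c))" for x
  obtain z where z: "z \<in> domf" "\<And>x. x \<in> domf \<Longrightarrow> fr z + q z \<le> fr x + q x"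
  proof (rule perturbed_minimiser[OF y, of q 0 0])
    show "continuous_on K q" unfolding q_def by (intro continuous_intros)
  qed (use k0 in \<open>auto simp: q_def\<close>)
  have grow: "f z + ereal ((- ((2 * k) *\<^sub>R (z - c))) \<bullet> (x - z)) \<le> f x" if "x \<in> K" for x
  proof (rule first_order_condition[where h = f and K = K and T = domf and q = q])
    show "(q has_derivative (\<bullet>) ((2 * k) *\<^sub>R (z - c))) (at z within domf)"
      unfolding q_def by (auto intro!: derivative_eq_intros simp: inner_commute)
    show "f z + ereal (q z) \<le> f x + ereal (q x)" if "x \<in> domf" for x
      using z(2)[OF that] z(1) that by (simp add: f_finite)
  qed (use convex_K f_not_minf f_convex z that in auto)
  have zs: "z \<in> doms"
  proof (rule subgradient_in_doms[OF z(1), of "- ((2 * k) *\<^sub>R (z - c))"], goal_cases)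
    case (1 x)
    from grow[OF domf_K[OF 1]] z(1) 1 show ?case by (simp add: f_finite)
  qed
  have "norm (z - c) < r"
  proof (rule ccontr)
    assume "\<not> norm (z - c) < r"
    then have ge: "r \<le> norm (z - c)" by simp
    define t where "t = norm (z - c)"
    have "k * t\<^sup>2 \<le> fr c - fr z" using z(2)[OF c] by (simp add: q_def t_def power2_norm_eq_inner)
    moreover have "fr y + gradf y \<bullet> (z - y) \<le> fr z"
      using breg_nonneg[OF z(1) y] by (simp add: breg_def)
    moreover have "- (gradf y \<bullet> (z - c)) \<le> norm (gradf y) * t"
      using norm_cauchy_schwarz[of "- gradf y" "z - c"] by (simp add: t_def)
    ultimately have "k * t\<^sup>2 \<le> B + norm (gradf y) * t"
      by (simp add: B_def inner_diff_right)
    moreover have "(B + norm (gradf y) * r + 1) * (t / r) \<le> k * t\<^sup>2"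
    proof -
      have "k * t\<^sup>2 = (k * r\<^sup>2) * (t / r) * (t / r)" using r(1) by (simp add: power2_eq_square)
      moreover have "(k * r\<^sup>2) * (t / r) * 1 \<le> (k * r\<^sup>2) * (t / r) * (t / r)"
        using ge r(1) k0 by (intro mult_left_mono) (auto simp: t_def)
      ultimately show ?thesis by (simp add: kr)
    qed
    moreover have "(B + norm (gradf y) * r + 1) * (t / r) = (B + 1) * (t / r) + norm (gradf y) * t"
      using r(1) by (simp add: field_simps)
    moreover have "B + 1 \<le> (B + 1) * (t / r)"
      using ge r(1) mult_left_mono[of 1 "t / r" "B + 1"] by (simp add: t_def B_def)
    ultimately have "(B + 1) + norm (gradf y) * t \<le> B + norm (gradf y) * t" by argo
    then show False by simp
  qed
  then have "z \<in> ball c r" by (simp add: dist_norm norm_minus_commute)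
  then have "z \<in> interior domf" using r(2) by (meson interior_maximal open_ball subsetD)
  with zs that show thesis by blast
qed

lemma interior_subgradient_unique:
  assumes x: "x \<in> interior domf" and v: "\<And>y. y \<in> domf \<Longrightarrow> fr x + v \<bullet> (y - x) \<le> fr y"
  shows "gradf x = v"
proof (rule ccontr)
  assume ne: "gradf x \<noteq> v"
  obtain r where r: "r > 0" "cball x r \<subseteq> domf" using x mem_interior_cball by blast
  define w where "w = v - gradf x"
  have w: "w \<noteq> 0" using ne by (simp add: w_def)
  define y where "y = x + (r / norm w) *\<^sub>R w"
  have "y \<in> domf" using r w by (auto simp: y_def dist_norm)
  then have "v \<bullet> (y - x) \<le> gradf x \<bullet> (y - x)"
    using subgradient_normal_cone[OF _ v] r centre_in_cball[of x r] by (meson less_imp_le subsetD)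
  then have "(r / norm w) * (w \<bullet> w) \<le> 0" by (simp add: y_def w_def inner_diff_left algebra_simps)
  moreover have "(r / norm w) * (w \<bullet> w) > 0" using r w by simp
  ultimately show False by simp
qed

text \<open>For small \<open>n\<close> the maximiser \<open>x\<close> stays interior, where the subgradient \<open>gradf z + n\<close> is the
  gradient. Then the conjugate equals \<open>D(z, x)\<close>, which dominates half the squared distance from \<open>z\<close> to \<open>x\<close>,
  and the Lipschitz bound for the gradient compares that distance with the dual norm of \<open>n\<close>.\<close>

lemma breg_conj_lower:
  assumes z: "z \<in> doms" "z \<in> interior domf"
    and lip: "\<And>x y. x \<in> K \<Longrightarrow> y \<in> K \<Longrightarrow> dual (gradf x - gradf y) \<le> l * N (x - y)"
  obtains \<epsilon> where "\<epsilon> > 0" "\<And>n. dual n < \<epsilon> \<Longrightarrow> (dual n)\<^sup>2 / 2 \<le> l\<^sup>2 * breg_conj z n"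
proof -
  obtain r where r: "r > 0" "ball z r \<subseteq> domf" using z(2) mem_interior by blast
  obtain k where k: "k > 0" "\<And>x. k * norm x \<le> N x" using euclidean_le_norm by blast
  show thesis
  proof (rule that[of "k * r / 2"])
    fix n assume small: "dual n < k * r / 2"
    obtain x where x: "x \<in> doms" and
      sub: "\<And>y. y \<in> domf \<Longrightarrow> fr x + (gradf z + n) \<bullet> (y - x) \<le> fr y" and
      "\<And>y. y \<in> domf \<Longrightarrow> n \<bullet> (y - z) - breg y z + (N (y - x))\<^sup>2 / 2 \<le> n \<bullet> (x - z) - breg x z" and
      val: "breg_conj z n = n \<bullet> (x - z) - breg x z"
      by (rule breg_conj_attained[OF z(1), of n]) (rule that)
    have "0 \<le> breg_conj z n"
      using breg_conj_fenchel[OF z(1) doms_domf[OF z(1)], of n] by (simp add: breg_self)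
    then have "(N (x - z))\<^sup>2 / 2 \<le> dual n * N (x - z)"
      using val breg_ge[OF doms_domf[OF x] z(1)] inner_le_dual[of n "x - z"] by linarith
    then have "N (x - z) * N (x - z) \<le> (2 * dual n) * N (x - z)" by (simp add: power2_eq_square)
    then have "N (x - z) \<le> 2 * dual n"
      using N_nonneg[of "x - z"] dual_nonneg[of n] by (auto simp: mult_le_cancel_right)
    then have "k * norm (x - z) < k * r" using small k(2)[of "x - z"] by linarith
    then have "x \<in> ball z r" using k(1) by (simp add: dist_norm norm_minus_commute)
    then have "x \<in> interior domf" using r(2) by (meson interior_maximal open_ball subsetD)
    then have grad: "gradf x = gradf z + n" using sub by (rule interior_subgradient_unique)
    have "breg_conj z n = breg z x"
      using breg_three_point[of z z x] val
      by (simp add: grad breg_self inner_diff_right)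
    then have low: "(N (x - z))\<^sup>2 / 2 \<le> breg_conj z n"
      using breg_ge[OF doms_domf[OF z(1)] x] N_minus_commute[of x z] by simp
    have "dual n \<le> l * N (x - z)"
      using lip[of x z] x z(1) grad by (simp add: doms_domf domf_K)
    then have "(dual n)\<^sup>2 \<le> (l * N (x - z))\<^sup>2" by (intro power_mono dual_nonneg)
    also have "\<dots> = 2 * (l\<^sup>2 * ((N (x - z))\<^sup>2 / 2))" by (simp add: power_mult_distrib)
    also have "\<dots> \<le> 2 * (l\<^sup>2 * breg_conj z n)" using low by (intro mult_left_mono) auto
    finally show "(dual n)\<^sup>2 / 2 \<le> l\<^sup>2 * breg_conj z n" by simp
  qed (use k r in auto)
qed

end

section \<open>Expectations over finitely many outcomes\<close>

lemma finite_set_replicate_pmf: "finite (set_pmf p) \<Longrightarrow> finite (set_pmf (replicate_pmf n p))"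
  using finite_lists_length_eq[of "set_pmf p" n]
  by (simp add: set_replicate_pmf lists_eq_set conj_commute)

lemma expectation_mono_finite:
  fixes u v :: "'b \<Rightarrow> real"
  assumes "finite (set_pmf p)" "\<And>x. x \<in> set_pmf p \<Longrightarrow> u x \<le> v x"
  shows "measure_pmf.expectation p u \<le> measure_pmf.expectation p v"
  using assms by (intro integral_mono_AE integrable_measure_pmf_finite) (auto simp: AE_measure_pmf_iff)

lemma expectation_cong_pmf:
  assumes "\<And>x. x \<in> set_pmf p \<Longrightarrow> u x = v x"
  shows "measure_pmf.expectation p u = measure_pmf.expectation p v"
  using assms by (intro integral_cong_AE) (auto simp: AE_measure_pmf_iff)

lemma expectation_bind_finite:
  fixes h :: "'c \<Rightarrow> real"
  assumes "finite (set_pmf p)" "\<And>x. x \<in> set_pmf p \<Longrightarrow> finite (set_pmf (r x))"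
  shows "measure_pmf.expectation (bind_pmf p r) h
    = measure_pmf.expectation p (\<lambda>x. measure_pmf.expectation (r x) h)"
  using pmf_expectation_bind[OF assms(1,2) order_refl, where h = h]
    integral_measure_pmf[OF assms(1), of p "\<lambda>x. measure_pmf.expectation (r x) h"]
  by simp

lemma expectation_pair_finite:
  fixes h :: "'b \<times> 'c \<Rightarrow> real"
  assumes "finite (set_pmf p)" "finite (set_pmf r)"
  shows "measure_pmf.expectation (pair_pmf p r) h
    = measure_pmf.expectation p (\<lambda>x. measure_pmf.expectation r (\<lambda>y. h (x, y)))"
  unfolding pair_pmf_def using assms by (simp add: expectation_bind_finite)

lemma expectation_inner_finite:
  fixes X :: "'b \<Rightarrow> 'a::euclidean_space"
  assumes "finite (set_pmf p)"
  shows "measure_pmf.expectation p (\<lambda>\<xi>. v \<bullet> X \<xi>) = v \<bullet> measure_pmf.expectation p X"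
  by (rule integral_inner_right) (use assms in \<open>auto intro: integrable_measure_pmf_finite\<close>)

lemma expectation_add_finite:
  fixes u v :: "'b \<Rightarrow> real"
  assumes "finite (set_pmf p)"
  shows "measure_pmf.expectation p (\<lambda>x. u x + v x) = measure_pmf.expectation p u + measure_pmf.expectation p v"
  by (rule Bochner_Integration.integral_add) (use assms in \<open>auto intro: integrable_measure_pmf_finite\<close>)

lemma expectation_sum_batch:
  fixes h :: "'b \<Rightarrow> real"
  assumes "finite (set_pmf p)"
  shows "measure_pmf.expectation (replicate_pmf n p) (\<lambda>B. \<Sum>\<xi>\<leftarrow>B. h \<xi>)
    = real n * measure_pmf.expectation p h"
proof (induction n)
  case (Suc n)
  have "measure_pmf.expectation (replicate_pmf (Suc n) p) (\<lambda>B. \<Sum>\<xi>\<leftarrow>B. h \<xi>)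
    = measure_pmf.expectation p (\<lambda>x. measure_pmf.expectation (replicate_pmf n p) (\<lambda>B. h x + (\<Sum>\<xi>\<leftarrow>B. h \<xi>)))"
    using assms by (simp add: expectation_bind_finite finite_set_replicate_pmf)
  also have "\<dots> = measure_pmf.expectation p (\<lambda>x. h x + real n * measure_pmf.expectation p h)"
    using assms by (simp only: expectation_add_finite finite_set_replicate_pmf Suc) simp
  also have "\<dots> = real (Suc n) * measure_pmf.expectation p h"
    using assms by (simp add: expectation_add_finite algebra_simps)
  finally show ?case .
qed simp

text \<open>Adding the samples one at a time, the tangent inequality with slope \<open>e\<close> at the current
  point bounds the value from above, its first-order part averages to the increment of the tangent
  along the mean, and the lower tangent inequality absorbs that part. Each sample therefore costs
  only a second moment, without centring and without an inner product structure on \<open>\<nu>\<close>.\<close>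

lemma smooth_minibatch:
  fixes \<phi> \<nu> :: "'a::euclidean_space \<Rightarrow> real" and X :: "'b \<Rightarrow> 'a"
  assumes fin: "finite (set_pmf p)"
    and smooth: "\<And>n. \<exists>e. \<forall>\<delta>. \<phi> n + e \<bullet> \<delta> \<le> \<phi> (n + \<delta>) \<and> \<phi> (n + \<delta>) \<le> \<phi> n + e \<bullet> \<delta> + (\<nu> \<delta>)\<^sup>2 / 2"
    and \<nu>: "\<And>x. (\<nu> (c *\<^sub>R x))\<^sup>2 = c\<^sup>2 * (\<nu> x)\<^sup>2"
    and \<mu>: "\<mu> = measure_pmf.expectation p X"
    and m2: "measure_pmf.expectation p (\<lambda>\<xi>. (\<nu> (X \<xi>))\<^sup>2) \<le> V"
  shows "measure_pmf.expectation (replicate_pmf b p) (\<lambda>B. \<phi> (v + c *\<^sub>R (\<Sum>\<xi>\<leftarrow>B. X \<xi>)))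
    \<le> \<phi> (v + (c * real b) *\<^sub>R \<mu>) + real b * (c\<^sup>2 * V / 2)"
proof (induction b arbitrary: v)
  case 0
  show ?case by simp
next
  case (Suc b)
  define T where "T = v + (c * real b) *\<^sub>R \<mu>"
  obtain e where low: "\<And>\<delta>. \<phi> T + e \<bullet> \<delta> \<le> \<phi> (T + \<delta>)"
    and up: "\<And>\<delta>. \<phi> (T + \<delta>) \<le> \<phi> T + e \<bullet> \<delta> + (\<nu> \<delta>)\<^sup>2 / 2"
    using smooth[of T] by blast
  have "measure_pmf.expectation (replicate_pmf (Suc b) p) (\<lambda>B. \<phi> (v + c *\<^sub>R (\<Sum>\<xi>\<leftarrow>B. X \<xi>)))
    = measure_pmf.expectation p (\<lambda>\<xi>. measure_pmf.expectation (replicate_pmf b p)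
        (\<lambda>B. \<phi> ((v + c *\<^sub>R X \<xi>) + c *\<^sub>R (\<Sum>\<xi>\<leftarrow>B. X \<xi>))))"
    using fin by (simp add: expectation_bind_finite finite_set_replicate_pmf scaleR_add_right add.assoc)
  also have "\<dots> \<le> measure_pmf.expectation p (\<lambda>\<xi>. (\<phi> T + real b * (c\<^sup>2 * V / 2)) + ((c *\<^sub>R e) \<bullet> X \<xi> + c\<^sup>2 / 2 * (\<nu> (X \<xi>))\<^sup>2))"
  proof (rule expectation_mono_finite[OF fin])
    fix \<xi>
    have "v + c *\<^sub>R X \<xi> + (c * real b) *\<^sub>R \<mu> = T + c *\<^sub>R X \<xi>" by (simp add: T_def)
    then have "measure_pmf.expectation (replicate_pmf b p) (\<lambda>B. \<phi> ((v + c *\<^sub>R X \<xi>) + c *\<^sub>R (\<Sum>\<xi>\<leftarrow>B. X \<xi>)))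
      \<le> \<phi> (T + c *\<^sub>R X \<xi>) + real b * (c\<^sup>2 * V / 2)"
      using Suc[of "v + c *\<^sub>R X \<xi>"] by metis
    then show "measure_pmf.expectation (replicate_pmf b p) (\<lambda>B. \<phi> ((v + c *\<^sub>R X \<xi>) + c *\<^sub>R (\<Sum>\<xi>\<leftarrow>B. X \<xi>)))
      \<le> (\<phi> T + real b * (c\<^sup>2 * V / 2)) + ((c *\<^sub>R e) \<bullet> X \<xi> + c\<^sup>2 / 2 * (\<nu> (X \<xi>))\<^sup>2)"
      using up[of "c *\<^sub>R X \<xi>"] by (simp add: \<nu>)
  qed
  also have "\<dots> = \<phi> T + real b * (c\<^sup>2 * V / 2) + (e \<bullet> (c *\<^sub>R \<mu>)
      + c\<^sup>2 / 2 * measure_pmf.expectation p (\<lambda>\<xi>. (\<nu> (X \<xi>))\<^sup>2))"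
    using fin by (simp add: expectation_add_finite expectation_inner_finite \<mu>
        integrable_measure_pmf_finite)
  also have "\<dots> \<le> \<phi> T + real b * (c\<^sup>2 * V / 2) + (e \<bullet> (c *\<^sub>R \<mu>) + c\<^sup>2 / 2 * V)"
    using m2 by (intro add_left_mono mult_left_mono) auto
  also have "\<dots> \<le> \<phi> (T + c *\<^sub>R \<mu>) + real (Suc b) * (c\<^sup>2 * V / 2)"
    using low[of "c *\<^sub>R \<mu>"] by (simp add: algebra_simps add_divide_distrib)
  also have "T + c *\<^sub>R \<mu> = v + (c * real (Suc b)) *\<^sub>R \<mu>" by (simp add: T_def algebra_simps)
  finally show ?case .
qed

context mirror_map
begin

lemma breg_conj_minibatch:
  assumes y: "y \<in> doms" and fin: "finite (set_pmf p)" and b: "b > 0"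
    and \<mu>: "\<mu> = measure_pmf.expectation p X"
    and m2: "measure_pmf.expectation p (\<lambda>\<xi>. (dual (X \<xi>))\<^sup>2) \<le> V"
  shows "measure_pmf.expectation (replicate_pmf b p)
      (\<lambda>B. breg_conj y (t *\<^sub>R ((1 / real b) *\<^sub>R (\<Sum>\<xi>\<leftarrow>B. X \<xi>))))
    \<le> t\<^sup>2 * ((dual \<mu>)\<^sup>2 + V / real b) / 2"
proof -
  have "measure_pmf.expectation (replicate_pmf b p) (\<lambda>B. breg_conj y (0 + (t / real b) *\<^sub>R (\<Sum>\<xi>\<leftarrow>B. X \<xi>)))
    \<le> breg_conj y (0 + (t / real b * real b) *\<^sub>R \<mu>) + real b * ((t / real b)\<^sup>2 * V / 2)"
    using breg_conj_smooth[OF y] by (intro smooth_minibatch[OF fin _ _ \<mu> m2])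
      (auto simp: dual_scaleR power_mult_distrib power_divide)
  also have "breg_conj y (0 + (t / real b * real b) *\<^sub>R \<mu>) \<le> t\<^sup>2 * (dual \<mu>)\<^sup>2 / 2"
    using breg_conj_le[OF y, of "t *\<^sub>R \<mu>"] b by (simp add: dual_scaleR power_mult_distrib)
  also have "real b * ((t / real b)\<^sup>2 * V / 2) = t\<^sup>2 * (V / real b) / 2"
    using b by (simp add: power2_eq_square field_simps)
  finally show ?thesis using b by (simp add: algebra_simps add_divide_distrib)
qed

text \<open>A general dual norm has no variance identity, so the second moment of an average over \<open>b\<close>
  samples need not decay like \<open>1 / b\<close>. At an interior point the conjugate of the Bregman distance
  is comparable, for small arguments, with the squared dual norm, up to the square of the Lipschitz
  constant of the gradient, and it does average.\<close>

lemma dual_minibatch_moment: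
  assumes y: "y \<in> doms" and fin: "finite (set_pmf p)" and b: "b > 0"
    and lip: "\<And>x y. x \<in> K \<Longrightarrow> y \<in> K \<Longrightarrow> dual (gradf x - gradf y) \<le> l * N (x - y)"
    and \<mu>: "\<mu> = measure_pmf.expectation p X"
    and m2: "measure_pmf.expectation p (\<lambda>\<xi>. (dual (X \<xi>))\<^sup>2) \<le> V"
  shows "measure_pmf.expectation (replicate_pmf b p)
      (\<lambda>B. (dual ((1 / real b) *\<^sub>R (\<Sum>\<xi>\<leftarrow>B. X \<xi>)))\<^sup>2) \<le> l\<^sup>2 * ((dual \<mu>)\<^sup>2 + V / real b)"
proof -
  obtain z where z: "z \<in> doms" "z \<in> interior domf" by (rule doms_meets_interior[OF y])
  obtain \<epsilon> where \<epsilon>: "\<epsilon> > 0" "\<And>n. dual n < \<epsilon> \<Longrightarrow> (dual n)\<^sup>2 / 2 \<le> l\<^sup>2 * breg_conj z n"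
    by (rule breg_conj_lower[OF z, of l]) (use lip in auto)
  define R where "R = replicate_pmf b p"
  define Y where "Y B = (1 / real b) *\<^sub>R (\<Sum>\<xi>\<leftarrow>B. X \<xi>)" for B
  have finR: "finite (set_pmf R)" unfolding R_def by (rule finite_set_replicate_pmf[OF fin])
  \<comment> \<open>finitely many batches can occur, so one scaling makes all their averages small\<close>
  define H where "H = (\<Sum>B\<in>set_pmf R. dual (Y B))"
  have H: "dual (Y B) \<le> H" if "B \<in> set_pmf R" for B
    unfolding H_def using finR that by (intro member_le_sum) (auto simp: dual_nonneg)
  have H0: "H \<ge> 0" unfolding H_def by (intro sum_nonneg dual_nonneg)
  define t where "t = \<epsilon> / (H + 1)"
  have t0: "t > 0" using \<epsilon>(1) H0 by (simp add: t_def)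
  have "t * H < \<epsilon>" using \<epsilon>(1) H0 by (simp add: t_def field_simps)
  have "(dual (Y B))\<^sup>2 \<le> (2 * l\<^sup>2 / t\<^sup>2) * breg_conj z (t *\<^sub>R Y B)" if "B \<in> set_pmf R" for B
  proof -
    have "dual (t *\<^sub>R Y B) \<le> t * H" using H[OF that] t0 by (simp add: dual_scaleR)
    then have "(dual (t *\<^sub>R Y B))\<^sup>2 / 2 \<le> l\<^sup>2 * breg_conj z (t *\<^sub>R Y B)"
      using \<open>t * H < \<epsilon>\<close> by (intro \<epsilon>(2)) simp
    then show ?thesis using t0 by (simp add: dual_scaleR power_mult_distrib field_simps)
  qed
  then have "measure_pmf.expectation R (\<lambda>B. (dual (Y B))\<^sup>2)
    \<le> measure_pmf.expectation R (\<lambda>B. (2 * l\<^sup>2 / t\<^sup>2) * breg_conj z (t *\<^sub>R Y B))"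
    by (intro expectation_mono_finite finR)
  also have "\<dots> = (2 * l\<^sup>2 / t\<^sup>2) * measure_pmf.expectation R (\<lambda>B. breg_conj z (t *\<^sub>R Y B))"
    by simp
  also have "\<dots> \<le> (2 * l\<^sup>2 / t\<^sup>2) * (t\<^sup>2 * ((dual \<mu>)\<^sup>2 + V / real b) / 2)"
    unfolding R_def Y_def
    by (intro mult_left_mono breg_conj_minibatch[OF z(1) fin b \<mu> m2]) simp
  also have "\<dots> = l\<^sup>2 * ((dual \<mu>)\<^sup>2 + V / real b)" using t0 by (simp add: field_simps)
  finally show ?thesis by (simp add: R_def Y_def)
qed

end

section \<open>Decoupling the coin from the step\<close>

text \<open>For \<open>x \<ge> 0\<close> the worst case is \<open>A = B + C\<close>, where the difference of the two sides is a square;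
  for \<open>x < 0\<close> it is \<open>C = A + B\<close>, a weighted Cauchy-Schwarz inequality. One formula covers both signs,
  so no case distinction on the coin probability is needed later.\<close>

lemma weighted_triangle_sq:
  fixes A B C x y :: real
  assumes y: "y > 0" "x < y" and nonneg: "0 \<le> A" "0 \<le> B" "0 \<le> C"
    and tri: "A \<le> B + C" "C \<le> A + B"
  shows "x * A\<^sup>2 - y * B\<^sup>2 \<le> x * y / (y - x) * C\<^sup>2"
proof -
  have "(y - x) * (x * A\<^sup>2 - y * B\<^sup>2) \<le> x * y * C\<^sup>2"
  proof (cases "x \<ge> 0")
    case True
    have "A\<^sup>2 \<le> (B + C)\<^sup>2" using nonneg tri by (intro power_mono) auto
    then have "(y - x) * x * A\<^sup>2 \<le> (y - x) * x * (B + C)\<^sup>2" using True y by (intro mult_left_mono) auto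
    moreover have "x * y * C\<^sup>2 - (y - x) * x * (B + C)\<^sup>2 + (y - x) * y * B\<^sup>2 = (x * C - (y - x) * B)\<^sup>2"
      by (simp add: power2_eq_square algebra_simps)
    moreover have "(y - x) * (x * A\<^sup>2 - y * B\<^sup>2) = (y - x) * x * A\<^sup>2 - (y - x) * y * B\<^sup>2"
      by (simp add: algebra_simps)
    ultimately show ?thesis using zero_le_power2[of "x * C - (y - x) * B"] by argo
  next
    case False
    have "C\<^sup>2 \<le> (A + B)\<^sup>2" using nonneg tri by (intro power_mono) auto
    then have "(- x) * y * C\<^sup>2 \<le> (- x) * y * (A + B)\<^sup>2" using False y
      by (intro mult_left_mono) (auto intro: mult_nonpos_nonneg)
    moreover have "(y - x) * (- x * A\<^sup>2 + y * B\<^sup>2) - (- x) * y * (A + B)\<^sup>2 = (x * A + y * B)\<^sup>2"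
      by (simp add: power2_eq_square algebra_simps)
    moreover have "(y - x) * (x * A\<^sup>2 - y * B\<^sup>2) = - ((y - x) * (- x * A\<^sup>2 + y * B\<^sup>2))"
      "x * y * C\<^sup>2 = - ((- x) * y * C\<^sup>2)"
      by (simp_all add: algebra_simps)
    ultimately show ?thesis using zero_le_power2[of "x * A + y * B"] by argo
  qed
  then show ?thesis using y by (simp add: field_simps)
qed

section \<open>One step of the method\<close>

locale variance_reduced_method = mirror_map N K f gradf
  for N :: "'a::euclidean_space \<Rightarrow> real" and K f gradf +
  fixes g :: "'a \<Rightarrow> ereal" and F :: "'a \<Rightarrow> 'a" and Fo :: "nat \<Rightarrow> 'a \<Rightarrow> 'a"
    and Q :: "'a \<Rightarrow> 'a \<Rightarrow> nat pmf" and M b :: nat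
    and L Lbar L\<^sub>f \<rho> \<alpha> \<gamma> p :: real and xstar :: 'a
  assumes g_proper: "proper_convex_lsc K g"
    and domg_domf: "edom K g \<subseteq> edom K f"
    and oracle_in_mean: "lipschitz_in_mean_oracle N M (edom K g) F Fo Q Lbar"
    and F_lipschitz: "\<And>x y. x \<in> K \<Longrightarrow> y \<in> K \<Longrightarrow> dual_norm N (F x - F y) \<le> L * N (x - y)"
    and weak_minty: "\<And>x v. x \<in> K \<Longrightarrow> v \<in> subdifferential (\<lambda>z. g z + indicator_ext K z) x \<Longrightarrow>
         - \<rho> * (dual_norm N (F x + v))\<^sup>2 \<le> (F x + v) \<bullet> (x - xstar)"
    and Lf_pos: "L\<^sub>f > 0"
    and gradf_lipschitz: "\<And>x y. x \<in> K \<Longrightarrow> y \<in> K \<Longrightarrow> dual_norm N (gradf x - gradf y) \<le> L\<^sub>f * N (x - y)"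
    and p_pos: "0 < p" and p_less: "p < \<gamma>" and \<gamma>_less: "\<gamma> < 1"
    and \<alpha>_pos: "\<alpha> > 0" and b_pos: "b > 0"
    and xstar: "xstar \<in> edom K f"
begin

abbreviation domg :: "'a set" where
  "domg \<equiv> edom K g"

definition next_point :: "'a iterate \<Rightarrow> nat list \<Rightarrow> 'a" where
  "next_point z B = arg_min_on (prox_objective g f gradf \<alpha> (direction F Fo B z) (xbar K f gradf \<gamma> z)) K"

definition advance :: "'a iterate \<Rightarrow> nat list \<Rightarrow> bool \<Rightarrow> 'a iterate" where
  "advance z B coin = \<lparr>xprev = xcur z, xcur = next_point z B, wprev = wcur z,
     wcur = (if coin then next_point z B else xcur z)\<rparr>"

definition residual :: "'a iterate \<Rightarrow> nat list \<Rightarrow> 'a" where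
  "residual z B = F (next_point z B) - direction F Fo B z
     - (1 / \<alpha>) *\<^sub>R (gradf (next_point z B) - mixed_gradient gradf \<gamma> z)"

definition batches :: "'a iterate \<Rightarrow> nat list pmf" where
  "batches z = replicate_pmf b (Q (xcur z) (wprev z))"

definition oracle_diff :: "'a iterate \<Rightarrow> nat list \<Rightarrow> 'a" where
  "oracle_diff z B = (1 / real b) *\<^sub>R (\<Sum>\<xi>\<leftarrow>B. Fo \<xi> (xcur z) - Fo \<xi> (wprev z))"

text \<open>The flag records the coin that produced the current \<open>w\<close>.\<close>

definition regular :: "'a iterate \<Rightarrow> bool \<Rightarrow> bool" where
  "regular z coin \<longleftrightarrow> {xprev z, xcur z, wprev z, wcur z} \<subseteq> domg \<inter> doms \<and>
     wcur z = (if coin then xcur z else xprev z)"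

text \<open>The points computed in the next step exist, whichever batch is drawn.\<close>

definition steppable :: "'a iterate \<Rightarrow> bool" where
  "steppable z \<longleftrightarrow> mixed_gradient gradf \<gamma> z \<in> gradf ` doms \<and>
     (\<forall>B\<in>set_pmf (batches z). next_point z B \<in> doms \<and>
        (\<exists>x. is_arg_min (prox_objective g f gradf \<alpha> (direction F Fo B z) (xbar K f gradf \<gamma> z)) (\<lambda>x. x \<in> K) x))"

lemma advance_simps [simp]:
  "xprev (advance z B coin) = xcur z" "xcur (advance z B coin) = next_point z B"
  "wprev (advance z B coin) = wcur z"
  "wcur (advance z B coin) = (if coin then next_point z B else xcur z)"
  by (simp_all add: advance_def)

lemma g_not_minf: "x \<in> K \<Longrightarrow> g x \<noteq> -\<infinity>"
  using g_proper by (simp add: proper_convex_lsc_def)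

lemma domg_K: "x \<in> domg \<Longrightarrow> x \<in> K"
  by (simp add: edom_def)

lemma g_finite: "x \<in> domg \<Longrightarrow> g x = ereal (real_of_ereal (g x))"
  using g_not_minf[of x] by (cases "g x") (auto simp: edom_def)

lemma batch_length: "B \<in> set_pmf (batches z) \<Longrightarrow> length B = b"
  by (simp add: batches_def set_replicate_pmf)

lemma direction_eq:
  assumes "length B = b"
  shows "direction F Fo B z = F (wcur z) + oracle_diff z B"
proof -
  have "(\<Sum>\<xi>\<leftarrow>B. F (wcur z) + Fo \<xi> (xcur z) - Fo \<xi> (wprev z))
    = real (length B) *\<^sub>R F (wcur z) + (\<Sum>\<xi>\<leftarrow>B. Fo \<xi> (xcur z) - Fo \<xi> (wprev z))"
    by (induction B) (simp_all add: algebra_simps)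
  then show ?thesis
    using assms b_pos by (simp add: direction_def oracle_diff_def scaleR_add_right)
qed

text \<open>The proximal objective differs by a constant from \<open>\<alpha>\<close> times the one below. Its value at \<open>xcur z\<close> is
  finite, which forces the minimiser into the domain of \<open>g\<close>.\<close>

lemma next_point_minimises:
  assumes "regular z coin" "steppable z" "B \<in> set_pmf (batches z)"
  shows "next_point z B \<in> domg" "next_point z B \<in> doms"
    "\<And>y. y \<in> domg \<Longrightarrow>
      g (next_point z B) + ereal (direction F Fo B z \<bullet> next_point z B
          + (1 / \<alpha>) * (fr (next_point z B) - mixed_gradient gradf \<gamma> z \<bullet> next_point z B))
      \<le> g y + ereal (direction F Fo B z \<bullet> y + (1 / \<alpha>) * (fr y - mixed_gradient gradf \<gamma> z \<bullet> y))"
proof -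
  define \<Delta> m xb x where "\<Delta> = direction F Fo B z" and "m = mixed_gradient gradf \<gamma> z"
    and "xb = xbar K f gradf \<gamma> z" and "x = next_point z B"
  define obj where "obj = prox_objective g f gradf \<alpha> \<Delta> xb"
  have m: "m \<in> gradf ` doms" using assms(2) by (simp add: steppable_def m_def)
  have xb: "xb \<in> doms" "gradf xb = m"
    using inv_into_into[OF m] f_inv_into_f[OF m] by (simp_all add: xb_def xbar_def m_def)
  obtain x1 where "is_arg_min obj (\<lambda>x. x \<in> K) x1"
    using assms(2,3) by (auto simp: steppable_def obj_def \<Delta>_def xb_def)
  then have "is_arg_min obj (\<lambda>x. x \<in> K) x"
    unfolding x_def next_point_def arg_min_on_def arg_min_def obj_def \<Delta>_def xb_def by (rule someI)
  then have xK: "x \<in> K" and min: "\<And>y. y \<in> K \<Longrightarrow> obj x \<le> obj y"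
    by (auto simp: is_arg_min_def not_less)
  show xs: "next_point z B \<in> doms" using assms(2,3) by (simp add: steppable_def)
  then have xf: "x \<in> domf" by (simp add: x_def doms_domf)
  have obj: "obj y = ereal \<alpha> * g y + ereal ((\<alpha> *\<^sub>R \<Delta>) \<bullet> y + breg y xb)" if "y \<in> domf" for y
    using bregman_eq_breg[OF that doms_domf[OF xb(1)]]
    by (simp add: obj_def prox_objective_def add.assoc)
  have cur: "xcur z \<in> domg" using assms(1) by (simp add: regular_def)
  have "obj x < \<infinity>"
    using min[OF domg_K[OF cur]] obj[of "xcur z"] cur domg_domf g_finite[OF cur]
    by (metis ereal_infty_less(1) ereal_infty_less_eq(1) plus_ereal.simps(1) subsetD times_ereal.simps(1) PInfty_neq_ereal(1))
  then have "g x \<noteq> \<infinity>" using obj[OF xf] \<alpha>_pos by auto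
  then show xg: "next_point z B \<in> domg" using xK by (simp add: edom_def x_def)
  fix y assume y: "y \<in> domg"
  then have yf: "y \<in> domf" using domg_domf by blast
  define gx gy where "gx = real_of_ereal (g x)" and "gy = real_of_ereal (g y)"
  have gx: "g x = ereal gx" and gy: "g y = ereal gy"
    using xg y g_finite by (auto simp: gx_def gy_def x_def)
  have "\<alpha> * gx + ((\<alpha> *\<^sub>R \<Delta>) \<bullet> x + breg x xb) \<le> \<alpha> * gy + ((\<alpha> *\<^sub>R \<Delta>) \<bullet> y + breg y xb)"
    using min[OF domg_K[OF y]] obj[OF xf] obj[OF yf] by (simp add: gx gy)
  then have "\<alpha> * (gx + (\<Delta> \<bullet> x + (1 / \<alpha>) * (fr x - m \<bullet> x))) \<le> \<alpha> * (gy + (\<Delta> \<bullet> y + (1 / \<alpha>) * (fr y - m \<bullet> y)))"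
    using \<alpha>_pos by (simp add: breg_def xb(2) inner_diff_right algebra_simps)
  then have "gx + (\<Delta> \<bullet> x + (1 / \<alpha>) * (fr x - m \<bullet> x)) \<le> gy + (\<Delta> \<bullet> y + (1 / \<alpha>) * (fr y - m \<bullet> y))"
    using \<alpha>_pos by simp
  then show "g (next_point z B) + ereal (direction F Fo B z \<bullet> next_point z B
          + (1 / \<alpha>) * (fr (next_point z B) - mixed_gradient gradf \<gamma> z \<bullet> next_point z B))
      \<le> g y + ereal (direction F Fo B z \<bullet> y + (1 / \<alpha>) * (fr y - mixed_gradient gradf \<gamma> z \<bullet> y))"
    using gx gy by (simp add: x_def \<Delta>_def m_def)
qed

text \<open>Optimality of the proximal step puts \<open>residual - F\<close> into the subdifferential of
  \<open>g\<close>, which is what lets the weak Minty inequality speak about the residual.\<close>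

lemma residual_minty:
  assumes "regular z coin" "steppable z" "B \<in> set_pmf (batches z)"
  shows "- \<rho> * (dual (residual z B))\<^sup>2 \<le> residual z B \<bullet> (next_point z B - xstar)"
proof -
  define x where "x = next_point z B"
  define q where "q y = direction F Fo B z \<bullet> y + (1 / \<alpha>) * (fr y - mixed_gradient gradf \<gamma> z \<bullet> y)" for y
  define v where "v = direction F Fo B z + (1 / \<alpha>) *\<^sub>R (gradf x - mixed_gradient gradf \<gamma> z)"
  note np = next_point_minimises[OF assms, folded x_def]
  have sub: "g x + ereal ((- v) \<bullet> (y - x)) \<le> g y" if "y \<in> K" for y
  proof (rule first_order_condition[where h = g and K = K and T = domf and q = q])
    show "(q has_derivative (\<bullet>) v) (at x within domf)"
      unfolding q_def v_def using \<alpha>_pos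
      by (auto intro!: derivative_eq_intros gradient_within np(2) simp: inner_add_left inner_diff_left)
    show "g x + ereal (q x) \<le> g y + ereal (q y)" if "y \<in> domg" for y
      using np(3)[OF that] by (simp add: q_def)
    show "g ((1 - t) *\<^sub>R x + t *\<^sub>R y) \<le> ereal (1 - t) * g x + ereal t * g y"
      if "x \<in> K" "y \<in> K" "t \<in> {0<..<1}" for x y t
      using g_proper that by (simp add: proper_convex_lsc_def)
  qed (use convex_K g_not_minf domg_domf np(1) that in auto)
  have "- v \<in> subdifferential (\<lambda>z. g z + indicator_ext K z) x"
    unfolding subdifferential_def
  proof (intro CollectI conjI allI)
    show "\<bar>g x + indicator_ext K x\<bar> \<noteq> \<infinity>"
      using domg_K[OF np(1)] by (subst g_finite[OF np(1)]) (simp add: indicator_ext_def)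
    show "g x + indicator_ext K x + ereal (- v \<bullet> (y - x)) \<le> g y + indicator_ext K y" for y
      using sub[of y] domg_K[OF np(1)] by (cases "y \<in> K") (auto simp: indicator_ext_def)
  qed
  then have "- \<rho> * (dual (F x + - v))\<^sup>2 \<le> (F x + - v) \<bullet> (x - xstar)"
    using domg_K[OF np(1)] by (rule weak_minty[rotated])
  moreover have "F x + - v = residual z B"
    by (simp add: residual_def v_def x_def algebra_simps)
  ultimately show ?thesis by (simp add: x_def)
qed

lemma regular_advance:
  assumes "regular z e" "steppable z" "B \<in> set_pmf (batches z)"
  shows "regular (advance z B coin) coin"
  using assms next_point_minimises(1,2)[OF assms] by (auto simp: regular_def)

lemma regularD:
  assumes "regular z coin"
  shows "xcur z \<in> domg" "xprev z \<in> domg" "wcur z \<in> domg" "wprev z \<in> domg"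
    "xcur z \<in> doms" "xprev z \<in> doms" "wcur z \<in> doms" "wprev z \<in> doms"
    "wcur z = (if coin then xcur z else xprev z)"
  using assms by (auto simp: regular_def)

lemma finite_Q: "regular z coin \<Longrightarrow> finite (set_pmf (Q (xcur z) (wprev z)))"
  using oracle_in_mean regularD[of z coin] unfolding lipschitz_in_mean_oracle_def
  by (meson finite_atLeastAtMost finite_subset)

lemma finite_batches: "regular z coin \<Longrightarrow> finite (set_pmf (batches z))"
  unfolding batches_def by (intro finite_set_replicate_pmf finite_Q)

lemma oracle_mean:
  assumes "regular z coin"
  shows "F (xcur z) - F (wprev z)
    = measure_pmf.expectation (Q (xcur z) (wprev z)) (\<lambda>\<xi>. Fo \<xi> (xcur z) - Fo \<xi> (wprev z))"
proof -
  have "F y = measure_pmf.expectation (Q (xcur z) (wprev z)) (\<lambda>\<xi>. Fo \<xi> y)" if "y \<in> domg" for y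
    using oracle_in_mean regularD[OF assms] that unfolding lipschitz_in_mean_oracle_def by blast
  moreover have "integrable (Q (xcur z) (wprev z)) (\<lambda>\<xi>. Fo \<xi> y)" for y
    by (rule integrable_measure_pmf_finite[OF finite_Q[OF assms]])
  ultimately show ?thesis using regularD[OF assms] by simp
qed

lemma oracle_moment:
  assumes "regular z coin"
  shows "measure_pmf.expectation (Q (xcur z) (wprev z)) (\<lambda>\<xi>. (dual (Fo \<xi> (xcur z) - Fo \<xi> (wprev z)))\<^sup>2)
    \<le> Lbar\<^sup>2 * (N (xcur z - wprev z))\<^sup>2"
  using oracle_in_mean regularD[OF assms] unfolding lipschitz_in_mean_oracle_def by blast

lemma F_lipschitz_sq: "x \<in> K \<Longrightarrow> y \<in> K \<Longrightarrow> (dual (F x - F y))\<^sup>2 \<le> L\<^sup>2 * (N (x - y))\<^sup>2"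
  using power_mono[OF F_lipschitz dual_nonneg, of x y 2] by (simp add: power_mult_distrib)

lemma gradf_lipschitz_sq:
  "x \<in> K \<Longrightarrow> y \<in> K \<Longrightarrow> (dual (gradf x - gradf y))\<^sup>2 \<le> L\<^sub>f\<^sup>2 * (N (x - y))\<^sup>2"
  using power_mono[OF gradf_lipschitz dual_nonneg, of x y 2] by (simp add: power_mult_distrib)

text \<open>Strong convexity and smoothness of \<open>f\<close> together force \<open>L\<^sub>f \<ge> 1\<close> as soon as two distinct
  points are available.\<close>

lemma dist_sq_le_Lf:
  assumes x: "x \<in> doms" and y: "y \<in> doms"
  shows "(N (x - y))\<^sup>2 \<le> L\<^sub>f\<^sup>2 * (N (x - y))\<^sup>2"
proof (cases "N (x - y) = 0")
  case False
  then have pos: "N (x - y) > 0" using N_nonneg[of "x - y"] by simp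
  have "(N (x - y))\<^sup>2 \<le> (gradf x - gradf y) \<bullet> (x - y)"
    using breg_ge[OF doms_domf[OF x] y] breg_ge[OF doms_domf[OF y] x] breg_three_point[of x x y]
      N_minus_commute[of x y] by (simp add: breg_self breg_def inner_diff_left inner_diff_right)
  also have "\<dots> \<le> dual (gradf x - gradf y) * N (x - y)" by (rule inner_le_dual)
  also have "\<dots> \<le> (L\<^sub>f * N (x - y)) * N (x - y)"
    using gradf_lipschitz[of x y] x y pos by (intro mult_right_mono) (auto simp: doms_domf domf_K)
  finally have "1 \<le> L\<^sub>f" using pos by (simp add: power2_eq_square)
  then have "1 \<le> L\<^sub>f\<^sup>2" by (simp add: one_le_power)
  then show ?thesis by (simp add: mult_le_cancel_right1)
qed simp

text \<open>The scale of the error of one step: squared step size times the squared deterministic Lipschitz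
  constant plus the oracle variance reduced by the batch size.\<close>

definition \<omega>\<^sub>L :: real where
  "\<omega>\<^sub>L = \<alpha>\<^sup>2 * L\<^sup>2 + \<alpha>\<^sup>2 * Lbar\<^sup>2 / real b"

lemma oracle_diff_mean:
  assumes "regular z coin"
  shows "measure_pmf.expectation (batches z) (\<lambda>B. oracle_diff z B \<bullet> v)
    = (F (xcur z) - F (wprev z)) \<bullet> v"
proof -
  let ?p = "Q (xcur z) (wprev z)" and ?X = "\<lambda>\<xi>. Fo \<xi> (xcur z) - Fo \<xi> (wprev z)"
  have "v \<bullet> (\<Sum>\<xi>\<leftarrow>B. ?X \<xi>) = (\<Sum>\<xi>\<leftarrow>B. v \<bullet> ?X \<xi>)" for B
    by (induction B) (simp_all add: inner_add_right)
  then have "measure_pmf.expectation (batches z) (\<lambda>B. v \<bullet> (\<Sum>\<xi>\<leftarrow>B. ?X \<xi>))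
    = real b * measure_pmf.expectation ?p (\<lambda>\<xi>. v \<bullet> ?X \<xi>)"
    by (simp only: batches_def expectation_sum_batch[OF finite_Q[OF assms]])
  also have "measure_pmf.expectation ?p (\<lambda>\<xi>. v \<bullet> ?X \<xi>) = (F (xcur z) - F (wprev z)) \<bullet> v"
    unfolding expectation_inner_finite[OF finite_Q[OF assms]] oracle_mean[OF assms] by (rule inner_commute)
  finally have "measure_pmf.expectation (batches z) (\<lambda>B. v \<bullet> (\<Sum>\<xi>\<leftarrow>B. ?X \<xi>))
    = real b * ((F (xcur z) - F (wprev z)) \<bullet> v)" .
  then show ?thesis using b_pos by (simp add: oracle_diff_def inner_commute[of _ v])
qed

text \<open>The tilt \<open>- 2 \<alpha>\<close> is the one for which the Fenchel inequality absorbs the noise pairing into half of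
  \<open>D(y, x)\<close>.\<close>

lemma oracle_diff_conj:
  assumes "regular z coin"
  shows "measure_pmf.expectation (batches z) (\<lambda>B. breg_conj (xcur z) ((- 2 * \<alpha>) *\<^sub>R oracle_diff z B))
    \<le> 2 * \<omega>\<^sub>L * (N (xcur z - wprev z))\<^sup>2"
proof -
  have "measure_pmf.expectation (batches z) (\<lambda>B. breg_conj (xcur z) ((- 2 * \<alpha>) *\<^sub>R oracle_diff z B))
    \<le> (- 2 * \<alpha>)\<^sup>2 * ((dual (F (xcur z) - F (wprev z)))\<^sup>2 + Lbar\<^sup>2 * (N (xcur z - wprev z))\<^sup>2 / real b) / 2"
    unfolding batches_def oracle_diff_def
    by (rule breg_conj_minibatch[OF regularD(5)[OF assms] finite_Q[OF assms] b_pos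
          oracle_mean[OF assms] oracle_moment[OF assms]])
  also have "\<dots> \<le> (- 2 * \<alpha>)\<^sup>2 * (L\<^sup>2 * (N (xcur z - wprev z))\<^sup>2 + Lbar\<^sup>2 * (N (xcur z - wprev z))\<^sup>2 / real b) / 2"
    using F_lipschitz_sq[of "xcur z" "wprev z"] regularD[OF assms]
    by (intro divide_right_mono mult_left_mono add_right_mono) (auto simp: domg_K)
  also have "\<dots> = 2 * \<omega>\<^sub>L * (N (xcur z - wprev z))\<^sup>2"
    by (simp add: \<omega>\<^sub>L_def power2_eq_square field_simps)
  finally show ?thesis .
qed

lemma oracle_diff_moment:
  assumes "regular z coin"
  shows "measure_pmf.expectation (batches z) (\<lambda>B. \<alpha>\<^sup>2 / L\<^sub>f\<^sup>2 * (dual (oracle_diff z B))\<^sup>2)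
    \<le> \<omega>\<^sub>L * (N (xcur z - wprev z))\<^sup>2"
proof -
  have "measure_pmf.expectation (batches z) (\<lambda>B. (dual (oracle_diff z B))\<^sup>2)
    \<le> L\<^sub>f\<^sup>2 * ((dual (F (xcur z) - F (wprev z)))\<^sup>2 + Lbar\<^sup>2 * (N (xcur z - wprev z))\<^sup>2 / real b)"
    unfolding batches_def oracle_diff_def
    by (rule dual_minibatch_moment[OF regularD(5)[OF assms] finite_Q[OF assms] b_pos
          gradf_lipschitz oracle_mean[OF assms] oracle_moment[OF assms]])
  also have "\<dots> \<le> L\<^sub>f\<^sup>2 * (L\<^sup>2 * (N (xcur z - wprev z))\<^sup>2 + Lbar\<^sup>2 * (N (xcur z - wprev z))\<^sup>2 / real b)"
    using F_lipschitz_sq[of "xcur z" "wprev z"] regularD[OF assms]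
    by (intro mult_left_mono add_right_mono) (auto simp: domg_K)
  finally have "\<alpha>\<^sup>2 / L\<^sub>f\<^sup>2 * measure_pmf.expectation (batches z) (\<lambda>B. (dual (oracle_diff z B))\<^sup>2)
    \<le> \<alpha>\<^sup>2 / L\<^sub>f\<^sup>2 * (L\<^sub>f\<^sup>2 * (L\<^sup>2 * (N (xcur z - wprev z))\<^sup>2 + Lbar\<^sup>2 * (N (xcur z - wprev z))\<^sup>2 / real b))"
    by (intro mult_left_mono) auto
  also have "\<dots> = \<omega>\<^sub>L * (N (xcur z - wprev z))\<^sup>2"
    using Lf_pos by (simp add: \<omega>\<^sub>L_def field_simps)
  finally show ?thesis by simp
qed

text \<open>The last term is the operator part of the previous step, which the unbiased oracle of the current
  step reproduces in expectation; it makes the inner products telescope.\<close>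

definition lyapunov :: "'a iterate \<Rightarrow> real" where
  "lyapunov z = breg xstar (xcur z) + (1 - \<gamma>) * breg xstar (xprev z)
     - \<alpha> * ((F (xcur z) - F (wprev z)) \<bullet> (xcur z - xstar))"

text \<open>The three-point identity for the two components of the mixed gradient converts the weak Minty
  inequality into Bregman distances; the oracle difference is split at \<open>xcur z\<close> into a part whose
  expectation is known and a part that the Fenchel inequality bounds.\<close>

lemma lyapunov_step:
  assumes "regular z coin" "steppable z" "B \<in> set_pmf (batches z)"
  shows "lyapunov (advance z B e) + (\<gamma> - 1/2) * breg (next_point z B) (xcur z)
      + (1 - \<gamma>) * breg (next_point z B) (xprev z)
    \<le> breg xstar (xcur z) + (1 - \<gamma>) * breg xstar (xprev z)
      + \<alpha> * \<rho> * (dual (residual z B))\<^sup>2 - \<alpha> * (oracle_diff z B \<bullet> (xcur z - xstar))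
      + breg_conj (xcur z) ((- 2 * \<alpha>) *\<^sub>R oracle_diff z B) / 2"
proof -
  define x x' y w X where "x = xcur z" and "x' = xprev z" and "y = next_point z B" and "w = wcur z"
    and "X = oracle_diff z B"
  define m where "m = gradf y - mixed_gradient gradf \<gamma> z"
  note np = next_point_minimises(1,2)[OF assms, folded y_def]
  have "\<alpha> *\<^sub>R residual z B = \<alpha> *\<^sub>R (F y - F w - X) - m"
    using \<alpha>_pos direction_eq[OF batch_length[OF assms(3)]]
    by (simp add: residual_def y_def w_def X_def m_def algebra_simps)
  then have "\<alpha> * (residual z B \<bullet> (y - xstar)) = (\<alpha> *\<^sub>R (F y - F w - X) - m) \<bullet> (y - xstar)"
    by (metis inner_scaleR_left)
  moreover have "\<alpha> * (- \<rho> * (dual (residual z B))\<^sup>2) \<le> \<alpha> * (residual z B \<bullet> (y - xstar))"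
    using residual_minty[OF assms] \<alpha>_pos by (intro mult_left_mono) (auto simp: y_def)
  ultimately have minty: "- (\<alpha> * \<rho> * (dual (residual z B))\<^sup>2)
      \<le> \<alpha> * ((F y - F w) \<bullet> (y - xstar)) - \<alpha> * (X \<bullet> (y - xstar)) - m \<bullet> (y - xstar)"
    by (simp add: inner_diff_left algebra_simps)
  have "m = \<gamma> *\<^sub>R (gradf y - gradf x) + (1 - \<gamma>) *\<^sub>R (gradf y - gradf x')"
    by (simp add: m_def mixed_gradient_def x_def x'_def algebra_simps)
  then have "m \<bullet> (y - xstar)
    = (\<gamma> *\<^sub>R (gradf y - gradf x) + (1 - \<gamma>) *\<^sub>R (gradf y - gradf x')) \<bullet> (y - xstar)"
    by (rule arg_cong)
  also have "\<dots>
    = - (\<gamma> * ((gradf y - gradf x) \<bullet> (xstar - y)) + (1 - \<gamma>) * ((gradf y - gradf x') \<bullet> (xstar - y)))"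
    by (simp add: inner_add_left inner_diff_left inner_diff_right algebra_simps)
  also have "\<dots> = - (\<gamma> * (breg xstar x - breg xstar y - breg y x)
      + (1 - \<gamma>) * (breg xstar x' - breg xstar y - breg y x'))"
    using breg_three_point[of xstar x y] breg_three_point[of xstar x' y] by simp
  finally have mval: "m \<bullet> (y - xstar) = breg xstar y - \<gamma> * (breg xstar x - breg y x)
      - (1 - \<gamma>) * (breg xstar x' - breg y x')"
    by (simp add: algebra_simps)
  have "((- 2 * \<alpha>) *\<^sub>R X) \<bullet> (y - x) \<le> breg y x + breg_conj x ((- 2 * \<alpha>) *\<^sub>R X)"
    using regularD(5)[OF assms(1)] np(2) by (intro breg_conj_fenchel) (auto simp: x_def doms_domf)
  then have fen: "- (\<alpha> * (X \<bullet> (y - x))) \<le> breg y x / 2 + breg_conj x ((- 2 * \<alpha>) *\<^sub>R X) / 2"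
    by simp
  have split: "\<alpha> * (X \<bullet> (y - xstar)) = \<alpha> * (X \<bullet> (y - x)) + \<alpha> * (X \<bullet> (x - xstar))"
    by (simp add: inner_diff_right algebra_simps)
  have "lyapunov (advance z B e) = breg xstar y + (1 - \<gamma>) * breg xstar x - \<alpha> * ((F y - F w) \<bullet> (y - xstar))"
    by (simp add: lyapunov_def x_def y_def w_def)
  then show ?thesis
    unfolding x_def[symmetric] x'_def[symmetric] y_def[symmetric] X_def[symmetric]
    using minty mval fen split by (simp add: algebra_simps)
qed

text \<open>Scaled by \<open>\<alpha>\<close>, the residual is the sum of an operator difference, the sampled oracle difference and
  the gradient increment. The weights 4, 4, 2 give the gradient part, which competes directly with the
  energy gain, the smallest factor.\<close>

lemma residual_bound:
  assumes "regular z coin" "steppable z" "B \<in> set_pmf (batches z)"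
  shows "\<alpha>\<^sup>2 / L\<^sub>f\<^sup>2 * (dual (residual z B))\<^sup>2
    \<le> 4 * (\<alpha>\<^sup>2 * L\<^sup>2) * (N (next_point z B - wcur z))\<^sup>2
      + 4 * (\<alpha>\<^sup>2 / L\<^sub>f\<^sup>2 * (dual (oracle_diff z B))\<^sup>2)
      + 2 * (\<gamma> * (N (next_point z B - xcur z))\<^sup>2 + (1 - \<gamma>) * (N (next_point z B - xprev z))\<^sup>2)"
proof -
  define x x' y w X where "x = xcur z" and "x' = xprev z" and "y = next_point z B" and "w = wcur z"
    and "X = oracle_diff z B"
  define m where "m = gradf y - mixed_gradient gradf \<gamma> z"
  note np = next_point_minimises(1,2)[OF assms, folded y_def]
  note reg = regularD[OF assms(1), folded x_def x'_def w_def]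
  have "\<alpha> *\<^sub>R residual z B = \<alpha> *\<^sub>R (F y - F w) + (- \<alpha>) *\<^sub>R X + (- m)"
    using \<alpha>_pos direction_eq[OF batch_length[OF assms(3)]]
    by (simp add: residual_def y_def w_def X_def m_def algebra_simps)
  then have "(dual (\<alpha> *\<^sub>R residual z B))\<^sup>2 \<le> 4 * (dual (\<alpha> *\<^sub>R (F y - F w)))\<^sup>2
      + 4 * (dual ((- \<alpha>) *\<^sub>R X))\<^sup>2 + 2 * (dual (- m))\<^sup>2"
    using dual_sq_sum3[of "\<alpha> *\<^sub>R (F y - F w)" "(- \<alpha>) *\<^sub>R X" "- m"] by simp
  then have "\<alpha>\<^sup>2 * (dual (residual z B))\<^sup>2
      \<le> 4 * (\<alpha>\<^sup>2 * (dual (F y - F w))\<^sup>2) + 4 * (\<alpha>\<^sup>2 * (dual X)\<^sup>2) + 2 * (dual m)\<^sup>2"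
    by (simp only: dual_scaleR dual_minus power_mult_distrib power2_abs power2_minus)
  moreover have "\<alpha>\<^sup>2 * (dual (F y - F w))\<^sup>2 \<le> \<alpha>\<^sup>2 * (L\<^sup>2 * (L\<^sub>f\<^sup>2 * (N (y - w))\<^sup>2))"
  proof (rule mult_left_mono)
    have "(dual (F y - F w))\<^sup>2 \<le> L\<^sup>2 * (N (y - w))\<^sup>2"
      using np reg by (intro F_lipschitz_sq domg_K)
    also have "\<dots> \<le> L\<^sup>2 * (L\<^sub>f\<^sup>2 * (N (y - w))\<^sup>2)"
      using np reg by (intro mult_left_mono dist_sq_le_Lf) auto
    finally show "(dual (F y - F w))\<^sup>2 \<le> L\<^sup>2 * (L\<^sub>f\<^sup>2 * (N (y - w))\<^sup>2)" .
  qed simp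
  moreover have "(dual m)\<^sup>2 \<le> L\<^sub>f\<^sup>2 * (\<gamma> * (N (y - x))\<^sup>2 + (1 - \<gamma>) * (N (y - x'))\<^sup>2)"
  proof -
    have "m = \<gamma> *\<^sub>R (gradf y - gradf x) + (1 - \<gamma>) *\<^sub>R (gradf y - gradf x')"
      by (simp add: m_def mixed_gradient_def x_def x'_def algebra_simps)
    then have "(dual m)\<^sup>2 \<le> \<gamma> * (dual (gradf y - gradf x))\<^sup>2 + (1 - \<gamma>) * (dual (gradf y - gradf x'))\<^sup>2"
      using dual_convex_sq[of \<gamma> "gradf y - gradf x" "gradf y - gradf x'"] p_pos p_less \<gamma>_less by simp
    also have "\<dots> \<le> \<gamma> * (L\<^sub>f\<^sup>2 * (N (y - x))\<^sup>2) + (1 - \<gamma>) * (L\<^sub>f\<^sup>2 * (N (y - x'))\<^sup>2)"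
      using np reg p_pos p_less \<gamma>_less
      by (intro add_mono mult_left_mono gradf_lipschitz_sq domg_K) auto
    finally show ?thesis by (simp add: algebra_simps)
  qed
  ultimately have "\<alpha>\<^sup>2 * (dual (residual z B))\<^sup>2 \<le> L\<^sub>f\<^sup>2 * (4 * (\<alpha>\<^sup>2 * L\<^sup>2) * (N (y - w))\<^sup>2
      + 2 * (\<gamma> * (N (y - x))\<^sup>2 + (1 - \<gamma>) * (N (y - x'))\<^sup>2)) + 4 * (\<alpha>\<^sup>2 * (dual X)\<^sup>2)"
    by (simp add: algebra_simps)
  then have "\<alpha>\<^sup>2 * (dual (residual z B))\<^sup>2 / L\<^sub>f\<^sup>2 \<le> (L\<^sub>f\<^sup>2 * (4 * (\<alpha>\<^sup>2 * L\<^sup>2) * (N (y - w))\<^sup>2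
      + 2 * (\<gamma> * (N (y - x))\<^sup>2 + (1 - \<gamma>) * (N (y - x'))\<^sup>2)) + 4 * (\<alpha>\<^sup>2 * (dual X)\<^sup>2)) / L\<^sub>f\<^sup>2"
    by (rule divide_right_mono) simp
  also have "\<dots> = 4 * (\<alpha>\<^sup>2 * L\<^sup>2) * (N (y - w))\<^sup>2 + 4 * (\<alpha>\<^sup>2 / L\<^sub>f\<^sup>2 * (dual X)\<^sup>2)
      + 2 * (\<gamma> * (N (y - x))\<^sup>2 + (1 - \<gamma>) * (N (y - x'))\<^sup>2)"
    using Lf_pos by (simp add: add_divide_distrib)
  finally show ?thesis by (simp add: x_def x'_def y_def w_def X_def)
qed

end

section \<open>The potential and its expected decrease\<close>

text \<open>The constant \<open>C\<close> is the factor in the final bound, and \<open>\<eta>\<close> measures, in units of \<open>L\<^sub>f\<^sup>2 / \<alpha>\<^sup>2\<close>, the total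
  weight \<open>1 / C + \<alpha> \<rho>\<close> with which the squared residual enters: once as the quantity to be bounded and once
  as the loss in the weak Minty inequality.\<close>

locale variance_reduced_rate = variance_reduced_method N K f gradf g F Fo Q M b L Lbar L\<^sub>f \<rho> \<alpha> \<gamma> p xstar
  for N :: "'a::euclidean_space \<Rightarrow> real" and K f gradf g F Fo Q M b L Lbar L\<^sub>f \<rho> \<alpha> \<gamma> p xstar +
  fixes C \<eta> :: real
  assumes C_pos: "C > 0" and \<eta>_nonneg: "\<eta> \<ge> 0"
    and cur_weight_large: "1 / 2 < (\<gamma> - p) / (1 - p)"
    and budget: "1 / C + \<alpha> * \<rho> = \<alpha>\<^sup>2 / L\<^sub>f\<^sup>2 * \<eta>"
    and \<eta>_le: "8 * \<eta> \<le> 1 - 1 / (2 * ((\<gamma> - p) / (1 - p)))"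
    and noise_le: "\<omega>\<^sub>L * (1 + 8 * \<eta>) \<le> (1 - \<gamma>) / (1 - p) / 4"
begin

text \<open>The weights of the current point and of the anchor in the gain: with \<open>a\<close> and \<open>c\<close> the squared
  distances to the current and the previous point,
  \<open>\<gamma> a + (1 - \<gamma>) c = cw a + dw (p a + (1 - p) c)\<close>.\<close>

definition cw :: real where "cw = (\<gamma> - p) / (1 - p)"

definition dw :: real where "dw = (1 - \<gamma>) / (1 - p)"

text \<open>Chosen so that \<open>\<kappa> cw = cw + 1/2\<close>: after giving up \<open>a / 4\<close> to the noise, \<open>(cw - 1/2) / 4\<close> times \<open>a\<close> is
  left to pay for the coin.\<close>

definition \<kappa> :: real where "\<kappa> = 1 + 1 / (2 * cw)"

text \<open>The coefficients that \<open>weighted_triangle_sq\<close> produces for the two possible anchors. They may have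
  opposite signs; only their mean has to be controlled.\<close>

definition coin_weight :: "bool \<Rightarrow> real" where
  "coin_weight coin = (if coin then \<kappa> * (1 - p) * (1 - \<kappa> * p) / (\<kappa> - 1)
     else \<kappa> * p * (1 - \<kappa> * (1 - p)) / (\<kappa> - 1))"

definition potential :: "'a iterate \<Rightarrow> bool \<Rightarrow> real" where
  "potential z coin = lyapunov z + (1 + 4 * \<eta>) * \<omega>\<^sub>L * (N (xcur z - wprev z))\<^sup>2
     + dw / 4 * coin_weight coin * (N (xcur z - xprev z))\<^sup>2"

lemma p_less_1: "p < 1"
  using p_less \<gamma>_less by simp

lemma weights:
  shows "cw + dw = 1" "1 / 2 < cw" "0 < dw" "cw < 1" "dw < 1 / 2"
    "\<gamma> = cw + dw * p" "1 - \<gamma> = dw * (1 - p)"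
proof -
  have "cw + dw = ((\<gamma> - p) + (1 - \<gamma>)) / (1 - p)" by (simp only: cw_def dw_def add_divide_distrib)
  then show s: "cw + dw = 1" using p_less_1 by simp
  show c: "1 / 2 < cw" using cur_weight_large by (simp add: cw_def)
  show d: "0 < dw" using \<gamma>_less p_less_1 by (simp add: dw_def)
  show "cw < 1" "dw < 1 / 2" using s c d by simp_all
  show "1 - \<gamma> = dw * (1 - p)" using p_less_1 by (simp add: dw_def)
  then show "\<gamma> = cw + dw * p" using s by (simp add: algebra_simps)
qed

lemma \<kappa>_bounds: "1 < \<kappa>" "\<kappa> < 2" "\<kappa> * cw = cw + 1 / 2" "8 * \<eta> \<le> 2 - \<kappa>"
proof -
  show "1 < \<kappa>" "\<kappa> < 2" using weights(2) by (simp_all add: \<kappa>_def field_simps)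
  show "\<kappa> * cw = cw + 1 / 2" using weights(2) by (simp add: \<kappa>_def field_simps)
  show "8 * \<eta> \<le> 2 - \<kappa>" using \<eta>_le by (simp add: \<kappa>_def cw_def)
qed

lemma \<omega>_nonneg: "0 \<le> \<omega>\<^sub>L"
  by (simp add: \<omega>\<^sub>L_def)

text \<open>Moving the multiple of the mixture to the left leaves a weighted difference of the squared distances
  to the two candidates for the anchor, which the distance between the candidates bounds.\<close>

lemma dist_to_anchor:
  assumes "regular z coin"
  shows "(N (y - wcur z))\<^sup>2 \<le> \<kappa> * (p * (N (y - xcur z))\<^sup>2 + (1 - p) * (N (y - xprev z))\<^sup>2)
    + coin_weight coin * (N (xcur z - xprev z))\<^sup>2"
proof -
  have tri: "N (y - xcur z) \<le> N (y - xprev z) + N (xcur z - xprev z)"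
    "N (y - xprev z) \<le> N (y - xcur z) + N (xcur z - xprev z)"
    "N (xcur z - xprev z) \<le> N (y - xcur z) + N (y - xprev z)"
    "N (xcur z - xprev z) \<le> N (y - xprev z) + N (y - xcur z)"
    using N_triangle_diff[of y "xcur z" "xprev z"] N_triangle_diff[of y "xprev z" "xcur z"]
      N_triangle_diff[of "xcur z" "xprev z" y] N_minus_commute[of "xcur z" "xprev z"]
      N_minus_commute[of "xcur z" y] by linarith+
  show ?thesis
  proof (cases coin)
    case True
    have "(1 - \<kappa> * p) * (N (y - xcur z))\<^sup>2 - (\<kappa> * (1 - p)) * (N (y - xprev z))\<^sup>2
      \<le> (1 - \<kappa> * p) * (\<kappa> * (1 - p)) / (\<kappa> * (1 - p) - (1 - \<kappa> * p)) * (N (xcur z - xprev z))\<^sup>2"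
    proof (rule weighted_triangle_sq)
      show "0 < \<kappa> * (1 - p)" using \<kappa>_bounds(1) p_pos p_less_1 by simp
      show "1 - \<kappa> * p < \<kappa> * (1 - p)" using \<kappa>_bounds(1) by (simp add: algebra_simps)
    qed (use tri in \<open>simp_all add: N_nonneg\<close>)
    moreover have "\<kappa> * (1 - p) - (1 - \<kappa> * p) = \<kappa> - 1" by (simp add: algebra_simps)
    moreover have "wcur z = xcur z" using regularD(9)[OF assms] True by simp
    ultimately show ?thesis using True by (simp add: coin_weight_def algebra_simps)
  next
    case False
    have "(1 - \<kappa> * (1 - p)) * (N (y - xprev z))\<^sup>2 - (\<kappa> * p) * (N (y - xcur z))\<^sup>2
      \<le> (1 - \<kappa> * (1 - p)) * (\<kappa> * p) / (\<kappa> * p - (1 - \<kappa> * (1 - p))) * (N (xcur z - xprev z))\<^sup>2"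
    proof (rule weighted_triangle_sq)
      show "0 < \<kappa> * p" using \<kappa>_bounds(1) p_pos p_less_1 by simp
      show "1 - \<kappa> * (1 - p) < \<kappa> * p" using \<kappa>_bounds(1) by (simp add: algebra_simps)
    qed (use tri in \<open>simp_all add: N_nonneg\<close>)
    moreover have "\<kappa> * p - (1 - \<kappa> * (1 - p)) = \<kappa> - 1" by (simp add: algebra_simps)
    moreover have "wcur z = xprev z" using regularD(9)[OF assms] False by simp
    ultimately show ?thesis using False by (simp add: coin_weight_def algebra_simps)
  qed
qed

text \<open>The mean is \<open>\<kappa> p (1 - p) (2 cw - 1)\<close>, and \<open>dw < 1/2\<close>, \<open>\<kappa> < 2\<close>, \<open>p (1 - p) \<le> 1/4\<close>.\<close>

lemma coin_weight_mean:
  shows "0 \<le> p * coin_weight True + (1 - p) * coin_weight False"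
    and "dw * (p * coin_weight True + (1 - p) * coin_weight False) \<le> cw - 1 / 2"
proof -
  have \<kappa>1: "\<kappa> - 1 = 1 / (2 * cw)" by (simp add: \<kappa>_def)
  have "p * coin_weight True + (1 - p) * coin_weight False
    = p * (\<kappa> * (1 - p) * (1 - \<kappa> * p) * (2 * cw)) + (1 - p) * (\<kappa> * p * (1 - \<kappa> * (1 - p)) * (2 * cw))"
    by (simp add: coin_weight_def \<kappa>1)
  also have "\<dots> = \<kappa> * (p * (1 - p)) * ((2 - \<kappa>) * (2 * cw))"
    by (simp add: algebra_simps)
  also have "(2 - \<kappa>) * (2 * cw) = 2 * cw - 1" using \<kappa>_bounds(3) by (simp add: algebra_simps)
  finally have mean: "p * coin_weight True + (1 - p) * coin_weight False
    = \<kappa> * (p * (1 - p)) * (2 * cw - 1)" .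
  show "0 \<le> p * coin_weight True + (1 - p) * coin_weight False"
    unfolding mean using \<kappa>_bounds(1) p_pos p_less_1 weights(2) by simp
  have pq: "p * (1 - p) \<le> 1 / 4"
    using zero_le_power2[of "p - 1/2"] by (simp add: power2_eq_square algebra_simps)
  have "(dw * \<kappa>) * (p * (1 - p)) \<le> (1 / 2 * 2) * (1 / 4)"
    using weights(3,5) \<kappa>_bounds(1,2) pq p_pos p_less_1 by (intro mult_mono) auto
  then have "((dw * \<kappa>) * (p * (1 - p))) * (2 * cw - 1) \<le> 1 / 2 * (2 * cw - 1)"
    using weights(2) by (intro mult_right_mono) auto
  then show "dw * (p * coin_weight True + (1 - p) * coin_weight False) \<le> cw - 1 / 2"
    unfolding mean by (simp add: algebra_simps)
qed

text \<open>All estimates that hold for every batch and coin, before averaging. The squared distance to the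
  new anchor is charged with total weight \<open>(1 + 8 \<eta>) \<omega>\<^sub>L \<le> dw / 4\<close>: \<open>4 \<eta>\<close> from the residual of this step and the rest
  as a reserve in the potential for the noise of the next step.\<close>

lemma potential_pathwise:
  assumes "regular z e" "steppable z" "B \<in> set_pmf (batches z)"
  shows "lyapunov (advance z B coin) + (1 + 4 * \<eta>) * \<omega>\<^sub>L * (N (next_point z B - wcur z))\<^sup>2
      + (dual (residual z B))\<^sup>2 / C + (cw - 1 / 2) / 4 * (N (next_point z B - xcur z))\<^sup>2
    \<le> breg xstar (xcur z) + (1 - \<gamma>) * breg xstar (xprev z)
      + dw / 4 * coin_weight e * (N (xcur z - xprev z))\<^sup>2
      - \<alpha> * (oracle_diff z B \<bullet> (xcur z - xstar))
      + breg_conj (xcur z) ((- 2 * \<alpha>) *\<^sub>R oracle_diff z B) / 2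
      + 4 * \<eta> * (\<alpha>\<^sup>2 / L\<^sub>f\<^sup>2 * (dual (oracle_diff z B))\<^sup>2)"
proof -
  define A B' R a0 U X where "A = (N (next_point z B - xcur z))\<^sup>2"
    and "B' = (N (next_point z B - xprev z))\<^sup>2" and "R = (N (next_point z B - wcur z))\<^sup>2"
    and "a0 = (N (xcur z - xprev z))\<^sup>2" and "U = (dual (residual z B))\<^sup>2"
    and "X = \<alpha>\<^sup>2 / L\<^sub>f\<^sup>2 * (dual (oracle_diff z B))\<^sup>2"
  note np = next_point_minimises(1,2)[OF assms]
  note reg = regularD[OF assms(1)]
  have R0: "0 \<le> R" by (simp add: R_def)
  have G0: "0 \<le> \<gamma> * A + (1 - \<gamma>) * B'" using p_pos p_less \<gamma>_less by (simp add: A_def B'_def)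
  have "A / 2 \<le> breg (next_point z B) (xcur z)" "B' / 2 \<le> breg (next_point z B) (xprev z)"
    using breg_ge[OF doms_domf[OF np(2)] reg(5)] breg_ge[OF doms_domf[OF np(2)] reg(6)]
    by (simp_all add: A_def B'_def)
  moreover have "\<gamma> - 1 / 2 > 0"
    using weights(2,3,6) p_pos mult_pos_pos[of dw p] by linarith
  ultimately have drop: "(\<gamma> - 1/2) * (A / 2) + (1 - \<gamma>) * (B' / 2)
    \<le> (\<gamma> - 1/2) * breg (next_point z B) (xcur z) + (1 - \<gamma>) * breg (next_point z B) (xprev z)"
    using \<gamma>_less by (intro add_mono mult_left_mono) auto
  have "U / C + \<alpha> * \<rho> * U = (1 / C + \<alpha> * \<rho>) * U" by (simp add: algebra_simps)
  also have "\<dots> = \<eta> * (\<alpha>\<^sup>2 / L\<^sub>f\<^sup>2 * U)" by (simp add: budget)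
  also have "\<dots> \<le> \<eta> * (4 * (\<alpha>\<^sup>2 * L\<^sup>2) * R + 4 * X + 2 * (\<gamma> * A + (1 - \<gamma>) * B'))"
    using residual_bound[OF assms] \<eta>_nonneg
    by (intro mult_left_mono) (auto simp: U_def R_def X_def A_def B'_def)
  also have "\<dots> = 4 * \<eta> * ((\<alpha>\<^sup>2 * L\<^sup>2) * R) + 4 * \<eta> * X + 2 * \<eta> * (\<gamma> * A + (1 - \<gamma>) * B')"
    by (simp add: algebra_simps)
  also have "\<dots> \<le> 4 * \<eta> * (\<omega>\<^sub>L * R) + 4 * \<eta> * X + 2 * \<eta> * (\<gamma> * A + (1 - \<gamma>) * B')"
    using \<eta>_nonneg R0 by (intro add_right_mono mult_left_mono mult_right_mono) (auto simp: \<omega>\<^sub>L_def)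
  finally have res: "U / C + \<alpha> * \<rho> * U
    \<le> 4 * \<eta> * (\<omega>\<^sub>L * R) + 4 * \<eta> * X + 2 * \<eta> * (\<gamma> * A + (1 - \<gamma>) * B')" .
  have "(\<omega>\<^sub>L * (1 + 8 * \<eta>)) * R \<le> dw / 4 * R"
    using noise_le R0 by (intro mult_right_mono) (auto simp: dw_def)
  also have "\<dots> \<le> dw / 4 * (\<kappa> * (p * A + (1 - p) * B') + coin_weight e * a0)"
    using dist_to_anchor[OF assms(1), of "next_point z B"] weights(3)
    by (intro mult_left_mono) (auto simp: A_def B'_def R_def a0_def)
  finally have anchor: "(\<omega>\<^sub>L * (1 + 8 * \<eta>)) * R
    \<le> \<kappa> / 4 * (dw * (p * A + (1 - p) * B')) + dw / 4 * coin_weight e * a0"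
    by (simp add: algebra_simps)
  have "\<kappa> / 4 * (\<gamma> * A + (1 - \<gamma>) * B') \<le> (1 / 2 - 2 * \<eta>) * (\<gamma> * A + (1 - \<gamma>) * B')"
    using \<kappa>_bounds(4) G0 by (intro mult_right_mono) auto
  moreover have "\<kappa> / 4 * (\<gamma> * A + (1 - \<gamma>) * B')
    = (cw + 1 / 2) / 4 * A + \<kappa> / 4 * (dw * (p * A + (1 - p) * B'))"
  proof -
    have "\<gamma> * A + (1 - \<gamma>) * B' = cw * A + dw * (p * A + (1 - p) * B')"
      unfolding weights(7) by (subst weights(6)) (simp add: algebra_simps)
    then have "\<kappa> / 4 * (\<gamma> * A + (1 - \<gamma>) * B') = \<kappa> / 4 * (cw * A + dw * (p * A + (1 - p) * B'))"
      by (rule arg_cong)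
    also have "\<dots> = (\<kappa> * cw) / 4 * A + \<kappa> / 4 * (dw * (p * A + (1 - p) * B'))"
      by (simp add: distrib_left)
    finally have "\<kappa> / 4 * (\<gamma> * A + (1 - \<gamma>) * B')
      = (\<kappa> * cw) / 4 * A + \<kappa> / 4 * (dw * (p * A + (1 - p) * B'))" .
    then show ?thesis by (simp only: \<kappa>_bounds(3))
  qed
  ultimately have gain: "(cw + 1 / 2) / 4 * A + \<kappa> / 4 * (dw * (p * A + (1 - p) * B'))
    \<le> (1 / 2 - 2 * \<eta>) * (\<gamma> * A + (1 - \<gamma>) * B')" by simp
  have "(1 / 2 - 2 * \<eta>) * (\<gamma> * A + (1 - \<gamma>) * B') - A / 4
    = (\<gamma> - 1/2) * (A / 2) + (1 - \<gamma>) * (B' / 2) - 2 * \<eta> * (\<gamma> * A + (1 - \<gamma>) * B')"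
    by (simp add: algebra_simps add_divide_distrib diff_divide_distrib)
  moreover have "(\<omega>\<^sub>L * (1 + 8 * \<eta>)) * R = (1 + 4 * \<eta>) * \<omega>\<^sub>L * R + 4 * \<eta> * (\<omega>\<^sub>L * R)"
    by (simp add: algebra_simps)
  moreover have "(cw + 1 / 2) / 4 * A - A / 4 = (cw - 1 / 2) / 4 * A"
    by (simp add: algebra_simps)
  ultimately show ?thesis
    using lyapunov_step[OF assms, of coin] drop res anchor gain
    unfolding A_def[symmetric] B'_def[symmetric] R_def[symmetric] a0_def[symmetric]
      U_def[symmetric] X_def[symmetric]
    by linarith
qed

lemma potential_advance:
  "potential (advance z B coin) coin = lyapunov (advance z B coin)
     + (1 + 4 * \<eta>) * \<omega>\<^sub>L * (N (next_point z B - wcur z))\<^sup>2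
     + dw / 4 * coin_weight coin * (N (next_point z B - xcur z))\<^sup>2"
  by (simp add: potential_def)

lemma lyapunov_coin_irrelevant: "lyapunov (advance z B coin) = lyapunov (advance z B True)"
  by (simp add: lyapunov_def)

lemma expected_potential_advance:
  "measure_pmf.expectation (bernoulli_pmf p) (\<lambda>coin. potential (advance z B coin) coin)
    = lyapunov (advance z B True) + (1 + 4 * \<eta>) * \<omega>\<^sub>L * (N (next_point z B - wcur z))\<^sup>2
      + dw * (p * coin_weight True + (1 - p) * coin_weight False) / 4 * (N (next_point z B - xcur z))\<^sup>2"
proof -
  have "measure_pmf.expectation (bernoulli_pmf p) (\<lambda>coin. potential (advance z B coin) coin)
    = potential (advance z B True) True * p + potential (advance z B False) False * (1 - p)"
    using p_pos p_less_1 by simp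
  then show ?thesis
    unfolding potential_advance lyapunov_coin_irrelevant[of z B False]
    by (simp add: algebra_simps add_divide_distrib diff_divide_distrib)
qed

text \<open>Averaging over the batch turns the oracle pairing into the telescoping inner product and the two
  noise terms into multiples of the reserve; averaging over the coin replaces its weight by the mean.\<close>

lemma potential_step:
  assumes "regular z e" "steppable z"
  shows "measure_pmf.expectation (batches z) (\<lambda>B. measure_pmf.expectation (bernoulli_pmf p)
      (\<lambda>coin. (dual (residual z B))\<^sup>2 / C + potential (advance z B coin) coin)) \<le> potential z e"
proof -
  note fin = finite_batches[OF assms(1)]
  define E :: "(nat list \<Rightarrow> real) \<Rightarrow> real" where "E = measure_pmf.expectation (batches z)"
  define S0 where "S0 = breg xstar (xcur z) + (1 - \<gamma>) * breg xstar (xprev z)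
      + dw / 4 * coin_weight e * (N (xcur z - xprev z))\<^sup>2"
  have "E (\<lambda>B. measure_pmf.expectation (bernoulli_pmf p)
      (\<lambda>coin. (dual (residual z B))\<^sup>2 / C + potential (advance z B coin) coin))
    \<le> E (\<lambda>B. S0 + ((- \<alpha>) * (oracle_diff z B \<bullet> (xcur z - xstar))
      + (1 / 2 * breg_conj (xcur z) ((- 2 * \<alpha>) *\<^sub>R oracle_diff z B)
      + 4 * \<eta> * (\<alpha>\<^sup>2 / L\<^sub>f\<^sup>2 * (dual (oracle_diff z B))\<^sup>2))))"
    unfolding E_def
  proof (rule expectation_mono_finite[OF fin])
    fix B assume B: "B \<in> set_pmf (batches z)"
    have "measure_pmf.expectation (bernoulli_pmf p)
      (\<lambda>coin. (dual (residual z B))\<^sup>2 / C + potential (advance z B coin) coin)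
      = (dual (residual z B))\<^sup>2 / C + measure_pmf.expectation (bernoulli_pmf p)
      (\<lambda>coin. potential (advance z B coin) coin)"
      by (subst expectation_add_finite) simp_all
    moreover have "dw * (p * coin_weight True + (1 - p) * coin_weight False) / 4 * (N (next_point z B - xcur z))\<^sup>2
      \<le> (cw - 1 / 2) / 4 * (N (next_point z B - xcur z))\<^sup>2"
      using coin_weight_mean(2) by (intro mult_right_mono divide_right_mono) auto
    ultimately show "measure_pmf.expectation (bernoulli_pmf p)
      (\<lambda>coin. (dual (residual z B))\<^sup>2 / C + potential (advance z B coin) coin)
      \<le> S0 + ((- \<alpha>) * (oracle_diff z B \<bullet> (xcur z - xstar))
      + (1 / 2 * breg_conj (xcur z) ((- 2 * \<alpha>) *\<^sub>R oracle_diff z B)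
      + 4 * \<eta> * (\<alpha>\<^sup>2 / L\<^sub>f\<^sup>2 * (dual (oracle_diff z B))\<^sup>2)))"
      using potential_pathwise[OF assms B, of True]
      unfolding expected_potential_advance S0_def by simp
  qed
  also have "\<dots> = S0 + ((- \<alpha>) * E (\<lambda>B. oracle_diff z B \<bullet> (xcur z - xstar))
      + (1 / 2 * E (\<lambda>B. breg_conj (xcur z) ((- 2 * \<alpha>) *\<^sub>R oracle_diff z B))
      + 4 * \<eta> * E (\<lambda>B. \<alpha>\<^sup>2 / L\<^sub>f\<^sup>2 * (dual (oracle_diff z B))\<^sup>2)))"
    unfolding E_def by (simp only: expectation_add_finite[OF fin] integral_mult_right_zero) simp
  also have "\<dots> \<le> S0 + ((- \<alpha>) * ((F (xcur z) - F (wprev z)) \<bullet> (xcur z - xstar))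
      + (1 / 2 * (2 * \<omega>\<^sub>L * (N (xcur z - wprev z))\<^sup>2)
      + 4 * \<eta> * (\<omega>\<^sub>L * (N (xcur z - wprev z))\<^sup>2)))"
    unfolding E_def oracle_diff_mean[OF assms(1)]
    using \<eta>_nonneg oracle_diff_conj[OF assms(1)] oracle_diff_moment[OF assms(1)]
    by (intro add_left_mono add_mono mult_left_mono) auto
  also have "\<dots> = potential z e"
    by (simp add: S0_def potential_def lyapunov_def algebra_simps)
  finally show ?thesis by (simp add: E_def)
qed

text \<open>The only negative term of the energy is absorbed, by Young's inequality, into \<open>D(x\<^sup>*, y)\<close> and the reserve.
  The coin weight itself may be negative, which is why an average over the last coin is taken.\<close>

lemma expected_potential_nonneg:
  assumes "regular z e" "steppable z"
  shows "0 \<le> measure_pmf.expectation (batches z) (\<lambda>B. measure_pmf.expectation (bernoulli_pmf p)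
      (\<lambda>coin. potential (advance z B coin) coin))"
proof -
  have "measure_pmf.expectation (batches z) (\<lambda>_. 0 :: real)
    \<le> measure_pmf.expectation (batches z) (\<lambda>B. measure_pmf.expectation (bernoulli_pmf p)
      (\<lambda>coin. potential (advance z B coin) coin))"
  proof (rule expectation_mono_finite[OF finite_batches[OF assms(1)]])
    fix B assume B: "B \<in> set_pmf (batches z)"
    define y w where "y = next_point z B" and "w = wcur z"
    note np = next_point_minimises(1,2)[OF assms B, folded y_def]
    note reg = regularD[OF assms(1), folded w_def]
    have "(\<alpha> *\<^sub>R (F y - F w)) \<bullet> (y - xstar) \<le> (dual (\<alpha> *\<^sub>R (F y - F w)))\<^sup>2 / 2 + (N (y - xstar))\<^sup>2 / 2"
      by (rule young)
    also have "(dual (\<alpha> *\<^sub>R (F y - F w)))\<^sup>2 \<le> \<alpha>\<^sup>2 * (L\<^sup>2 * (N (y - w))\<^sup>2)"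
      unfolding dual_scaleR power_mult_distrib power2_abs
      using np reg by (intro mult_left_mono F_lipschitz_sq domg_K) auto
    also have "\<alpha>\<^sup>2 * (L\<^sup>2 * (N (y - w))\<^sup>2) \<le> \<omega>\<^sub>L * (N (y - w))\<^sup>2"
      unfolding mult.assoc[symmetric] by (intro mult_right_mono) (auto simp: \<omega>\<^sub>L_def)
    also have "(N (y - xstar))\<^sup>2 / 2 \<le> breg xstar y"
      using breg_ge[OF xstar np(2)] N_minus_commute[of y xstar] by simp
    finally have "\<alpha> * ((F y - F w) \<bullet> (y - xstar)) \<le> \<omega>\<^sub>L * (N (y - w))\<^sup>2 / 2 + breg xstar y" by simp
    moreover have "0 \<le> (1 - \<gamma>) * breg xstar (xcur z)"
      using \<gamma>_less breg_nonneg[OF xstar reg(5)] by simp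
    moreover have "lyapunov (advance z B True) = breg xstar y + (1 - \<gamma>) * breg xstar (xcur z)
        - \<alpha> * ((F y - F w) \<bullet> (y - xstar))"
      by (simp add: lyapunov_def y_def w_def)
    moreover have "1 * (\<omega>\<^sub>L * (N (y - w))\<^sup>2) \<le> (1 + 4 * \<eta>) * (\<omega>\<^sub>L * (N (y - w))\<^sup>2)"
      using \<eta>_nonneg \<omega>_nonneg by (intro mult_right_mono) auto
    moreover have "0 \<le> \<omega>\<^sub>L * (N (y - w))\<^sup>2" using \<omega>_nonneg by simp
    moreover have "0 \<le> dw * (p * coin_weight True + (1 - p) * coin_weight False) / 4 * (N (y - xcur z))\<^sup>2"
      using coin_weight_mean(1) weights(3) by (intro mult_nonneg_nonneg divide_nonneg_nonneg) auto
    ultimately show "0 \<le> measure_pmf.expectation (bernoulli_pmf p) (\<lambda>coin. potential (advance z B coin) coin)"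
      unfolding expected_potential_advance y_def[symmetric] w_def[symmetric] mult.assoc[of _ \<omega>\<^sub>L] by linarith
  qed
  then show ?thesis by simp
qed

end

section \<open>The whole run\<close>

lemma finite_set_pmf_bernoulli: "finite (set_pmf (bernoulli_pmf r))"
  by (rule finite)

lemma iterates_prefix:
  "(\<And>i. i < s \<Longrightarrow> \<omega> i = \<omega>' i) \<Longrightarrow>
    iterates K g f gradf F Fo \<alpha> \<gamma> x0 \<omega> s = iterates K g f gradf F Fo \<alpha> \<gamma> x0 \<omega>' s"
  by (induction s) simp_all

text \<open>The well-definedness assumptions speak about complete runs; every partial run is the beginning of one.\<close>

lemma outcome_pmf_extends:
  assumes "n \<le> m" "\<omega> \<in> set_pmf (outcome_pmf Q p b zs n)"
  shows "\<exists>\<omega>'\<in>set_pmf (outcome_pmf Q p b zs m). \<forall>i<n. \<omega>' i = \<omega> i"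
  using assms(1)
proof (induction m rule: dec_induct)
  case base
  then show ?case using assms(2) by blast
next
  case (step m)
  then obtain \<omega>' where \<omega>': "\<omega>' \<in> set_pmf (outcome_pmf Q p b zs m)" "\<forall>i<n. \<omega>' i = \<omega> i" by blast
  obtain d where d: "d \<in> set_pmf (pair_pmf (replicate_pmf b (Q (xcur (zs \<omega>' m)) (wprev (zs \<omega>' m)))) (bernoulli_pmf p))"
    using set_pmf_not_empty by fast
  have "(fun_upd \<omega>' m d) \<in> set_pmf (outcome_pmf Q p b zs (Suc m))" using \<omega>'(1) d by auto
  moreover have "\<forall>i<n. (fun_upd \<omega>' m d) i = \<omega> i" using \<omega>'(2) step(1) by auto
  ultimately show ?case by blast
qed

locale variance_reduced_run = variance_reduced_rate N K f gradf g F Fo Q M b L Lbar L\<^sub>f \<rho> \<alpha> \<gamma> p xstar C \<eta>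
  for N :: "'a::euclidean_space \<Rightarrow> real" and K f gradf g F Fo Q M b L Lbar L\<^sub>f \<rho> \<alpha> \<gamma> p xstar C \<eta> +
  fixes x0 :: 'a and S :: nat and zs :: "(nat \<Rightarrow> nat list \<times> bool) \<Rightarrow> nat \<Rightarrow> 'a iterate"
  assumes zs: "zs = iterates K g f gradf F Fo \<alpha> \<gamma> x0"
    and x0: "x0 \<in> edom K g"
    and well_defined_x:
      "\<And>\<omega> s. \<omega> \<in> set_pmf (outcome_pmf Q p b zs S) \<Longrightarrow> s \<le> S \<Longrightarrow> xcur (zs \<omega> s) \<in> dom_subdiff K f"
    and well_defined_xbar:
      "\<And>\<omega> s. \<omega> \<in> set_pmf (outcome_pmf Q p b zs S) \<Longrightarrow> s < S \<Longrightarrow>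
         mixed_gradient gradf \<gamma> (zs \<omega> s) \<in> gradf ` dom_subdiff K f"
    and well_defined_argmin:
      "\<And>\<omega> s. \<omega> \<in> set_pmf (outcome_pmf Q p b zs S) \<Longrightarrow> s < S \<Longrightarrow>
         \<exists>x. is_arg_min (prox_objective g f gradf \<alpha> (direction F Fo (fst (\<omega> s)) (zs \<omega> s))
           (xbar K f gradf \<gamma> (zs \<omega> s))) (\<lambda>x. x \<in> K) x"
begin

definition outcomes :: "nat \<Rightarrow> (nat \<Rightarrow> nat list \<times> bool) pmf" where
  "outcomes n = outcome_pmf Q p b zs n"

text \<open>At the start all points coincide, so either value of the coin describes the anchor.\<close>

definition last_coin :: "(nat \<Rightarrow> nat list \<times> bool) \<Rightarrow> nat \<Rightarrow> bool" where
  "last_coin \<omega> n = (case n of 0 \<Rightarrow> True | Suc m \<Rightarrow> snd (\<omega> m))"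

lemma zs_0: "zs \<omega> 0 = \<lparr>xprev = x0, xcur = x0, wprev = x0, wcur = x0\<rparr>"
  by (simp add: zs)

lemma zs_Suc: "zs \<omega> (Suc s) = advance (zs \<omega> s) (fst (\<omega> s)) (snd (\<omega> s))"
  by (simp add: zs advance_def next_point_def Let_def case_prod_beta)

lemma zs_upd: "s \<le> n \<Longrightarrow> zs (fun_upd \<omega> n d) s = zs \<omega> s"
  unfolding zs by (rule iterates_prefix) simp

lemma outcomes_Suc:
  "outcomes (Suc n) = bind_pmf (outcomes n) (\<lambda>\<omega>.
     map_pmf (\<lambda>d. fun_upd \<omega> n d) (pair_pmf (batches (zs \<omega> n)) (bernoulli_pmf p)))"
  by (simp add: outcomes_def batches_def)

lemma coin_support: "set_pmf (bernoulli_pmf p) = UNIV"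
  using p_pos p_less_1 by simp

lemma outcomes_Suc_support:
  "set_pmf (outcomes (Suc n)) = (\<Union>\<omega>\<in>set_pmf (outcomes n).
     (\<lambda>d. (fun_upd \<omega> n d)) ` (set_pmf (batches (zs \<omega> n)) \<times> UNIV))"
  by (simp add: outcomes_Suc coin_support)

lemma x_in_doms:
  assumes "\<omega> \<in> set_pmf (outcomes n)" "n \<le> S"
  shows "xcur (zs \<omega> n) \<in> doms"
proof -
  obtain \<omega>' where \<omega>': "\<omega>' \<in> set_pmf (outcomes S)" "\<forall>i<n. \<omega>' i = \<omega> i"
    using outcome_pmf_extends[OF assms(2)] assms(1) unfolding outcomes_def by blast
  have "zs \<omega>' n = zs \<omega> n" unfolding zs using \<omega>'(2) by (intro iterates_prefix) simp
  then show ?thesis using well_defined_x[of \<omega>' n] \<omega>'(1) assms(2) by (simp add: outcomes_def)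
qed

lemma x0_doms: "x0 \<in> doms"
  using x_in_doms[of _ 0] by (simp add: outcomes_def zs_0)

lemma run_steppable:
  assumes "\<omega> \<in> set_pmf (outcomes n)" "n < S"
  shows "steppable (zs \<omega> n)"
  unfolding steppable_def
proof (intro conjI ballI)
  have ext: "\<exists>\<omega>'\<in>set_pmf (outcomes S). fst (\<omega>' n) = B \<and> zs \<omega>' n = zs \<omega> n"
    if B: "B \<in> set_pmf (batches (zs \<omega> n))" for B
  proof -
    have "(fun_upd \<omega> n (B, True)) \<in> set_pmf (outcomes (Suc n))"
      unfolding outcomes_Suc_support using assms(1) B by blast
    then obtain \<omega>' where \<omega>': "\<omega>' \<in> set_pmf (outcomes S)" "\<forall>i<Suc n. \<omega>' i = (fun_upd \<omega> n (B, True)) i"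
      using outcome_pmf_extends[of "Suc n" S] assms(2) unfolding outcomes_def by (metis Suc_leI)
    have "zs \<omega>' n = zs \<omega> n" unfolding zs using \<omega>'(2) by (intro iterates_prefix) simp
    then show ?thesis using \<omega>' by (intro bexI[of _ \<omega>']) simp_all
  qed
  obtain B0 where "B0 \<in> set_pmf (batches (zs \<omega> n))" using set_pmf_not_empty by fast
  from ext[OF this] show "mixed_gradient gradf \<gamma> (zs \<omega> n) \<in> gradf ` doms"
    using well_defined_xbar assms(2) unfolding outcomes_def by metis
  fix B assume B: "B \<in> set_pmf (batches (zs \<omega> n))"
  from ext[OF B] show "\<exists>x. is_arg_min (prox_objective g f gradf \<alpha> (direction F Fo B (zs \<omega> n))
      (xbar K f gradf \<gamma> (zs \<omega> n))) (\<lambda>x. x \<in> K) x"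
    using well_defined_argmin assms(2) unfolding outcomes_def by metis
  have "(fun_upd \<omega> n (B, True)) \<in> set_pmf (outcomes (Suc n))"
    unfolding outcomes_Suc_support using assms(1) B by blast
  then show "next_point (zs \<omega> n) B \<in> doms"
    using x_in_doms[of "(fun_upd \<omega> n (B, True))" "Suc n"] assms(2) by (simp add: zs_Suc zs_upd)
qed

lemma run_regular:
  assumes "\<omega> \<in> set_pmf (outcomes n)" "n \<le> S"
  shows "regular (zs \<omega> n) (last_coin \<omega> n)"
  using assms
proof (induction n arbitrary: \<omega>)
  case 0
  then show ?case using x0 x0_doms by (simp add: regular_def zs_0 last_coin_def)
next
  case (Suc n)
  then obtain \<omega>0 B coin where w: "\<omega>0 \<in> set_pmf (outcomes n)" "B \<in> set_pmf (batches (zs \<omega>0 n))"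
    "\<omega> = (fun_upd \<omega>0 n (B, coin))"
    unfolding outcomes_Suc_support by auto
  have "regular (advance (zs \<omega>0 n) B coin) coin"
    using regular_advance[OF Suc.IH[OF w(1)] run_steppable[OF w(1)] w(2)] Suc.prems(2) by simp
  then show ?case unfolding w(3) last_coin_def zs_Suc zs_upd[OF order_refl] by simp
qed

lemma finite_outcomes: "n \<le> S \<Longrightarrow> finite (set_pmf (outcomes n))"
proof (induction n)
  case 0
  then show ?case by (simp add: outcomes_def)
next
  case (Suc n)
  then show ?case unfolding outcomes_Suc_support
    using finite_batches[OF run_regular] by auto
qed

lemma expectation_outcomes_Suc:
  fixes h :: "(nat \<Rightarrow> nat list \<times> bool) \<Rightarrow> real"
  assumes n: "n < S"
  shows "measure_pmf.expectation (outcomes (Suc n)) h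
    = measure_pmf.expectation (outcomes n) (\<lambda>\<omega>. measure_pmf.expectation (batches (zs \<omega> n))
        (\<lambda>B. measure_pmf.expectation (bernoulli_pmf p) (\<lambda>coin. h (fun_upd \<omega> n (B, coin)))))"
proof -
  have fin: "finite (set_pmf (batches (zs \<omega> n)))" if "\<omega> \<in> set_pmf (outcomes n)" for \<omega>
    using finite_batches[OF run_regular[OF that]] n by simp
  have "measure_pmf.expectation (outcomes (Suc n)) h
    = measure_pmf.expectation (outcomes n) (\<lambda>\<omega>. measure_pmf.expectation
        (map_pmf (\<lambda>d. fun_upd \<omega> n d) (pair_pmf (batches (zs \<omega> n)) (bernoulli_pmf p))) h)"
    unfolding outcomes_Suc
    by (rule expectation_bind_finite) (use n fin finite_outcomes in \<open>auto simp: coin_support\<close>)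
  also have "\<dots> = measure_pmf.expectation (outcomes n) (\<lambda>\<omega>. measure_pmf.expectation (batches (zs \<omega> n))
        (\<lambda>B. measure_pmf.expectation (bernoulli_pmf p) (\<lambda>coin. h (fun_upd \<omega> n (B, coin)))))"
    by (rule expectation_cong_pmf)
      (simp only: integral_map_pmf expectation_pair_finite[OF fin finite_set_pmf_bernoulli])
  finally show ?thesis .
qed

definition cost :: "(nat \<Rightarrow> nat list \<times> bool) \<Rightarrow> nat \<Rightarrow> real" where
  "cost \<omega> n = (\<Sum>s<n. (dual (residual (zs \<omega> s) (fst (\<omega> s))))\<^sup>2)"

lemma cost_upd:
  "cost (fun_upd \<omega> n (B, coin)) (Suc n) = cost \<omega> n + (dual (residual (zs \<omega> n) B))\<^sup>2"
  by (simp add: cost_def zs_upd)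

lemma potential_upd:
  "potential (zs (fun_upd \<omega> n (B, coin)) (Suc n)) (last_coin (fun_upd \<omega> n (B, coin)) (Suc n))
    = potential (advance (zs \<omega> n) B coin) coin"
  by (simp add: zs_Suc zs_upd last_coin_def)

lemma expected_cost_and_potential:
  "n \<le> S \<Longrightarrow> measure_pmf.expectation (outcomes n)
      (\<lambda>\<omega>. cost \<omega> n / C + potential (zs \<omega> n) (last_coin \<omega> n)) \<le> (2 - \<gamma>) * breg xstar x0"
proof (induction n)
  case 0
  show ?case
    using N_zero_iff[of 0]
    by (simp add: outcomes_def cost_def potential_def lyapunov_def zs_0 algebra_simps)
next
  case (Suc n)
  have "measure_pmf.expectation (outcomes (Suc n))
      (\<lambda>\<omega>. cost \<omega> (Suc n) / C + potential (zs \<omega> (Suc n)) (last_coin \<omega> (Suc n)))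
    \<le> measure_pmf.expectation (outcomes n) (\<lambda>\<omega>. cost \<omega> n / C + potential (zs \<omega> n) (last_coin \<omega> n))"
    unfolding expectation_outcomes_Suc[OF Suc_le_lessD[OF Suc.prems]]
  proof (rule expectation_mono_finite)
    show "finite (set_pmf (outcomes n))" using Suc.prems by (simp add: finite_outcomes)
    fix \<omega> assume \<omega>: "\<omega> \<in> set_pmf (outcomes n)"
    have reg: "regular (zs \<omega> n) (last_coin \<omega> n)" using run_regular[OF \<omega>] Suc.prems by simp
    have st: "steppable (zs \<omega> n)" using run_steppable[OF \<omega>] Suc.prems by simp
    have "measure_pmf.expectation (batches (zs \<omega> n)) (\<lambda>B. measure_pmf.expectation (bernoulli_pmf p)
        (\<lambda>coin. cost \<omega> n / C + ((dual (residual (zs \<omega> n) B))\<^sup>2 / C + potential (advance (zs \<omega> n) B coin) coin)))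
      = cost \<omega> n / C + measure_pmf.expectation (batches (zs \<omega> n)) (\<lambda>B. measure_pmf.expectation (bernoulli_pmf p)
        (\<lambda>coin. (dual (residual (zs \<omega> n) B))\<^sup>2 / C + potential (advance (zs \<omega> n) B coin) coin))"
      by (simp only: expectation_add_finite[OF finite_set_pmf_bernoulli]
          expectation_add_finite[OF finite_batches[OF reg]]) simp
    then show "measure_pmf.expectation (batches (zs \<omega> n)) (\<lambda>B. measure_pmf.expectation (bernoulli_pmf p)
        (\<lambda>coin. cost (fun_upd \<omega> n (B, coin)) (Suc n) / C + potential (zs (fun_upd \<omega> n (B, coin)) (Suc n))
          (last_coin (fun_upd \<omega> n (B, coin)) (Suc n))))
      \<le> cost \<omega> n / C + potential (zs \<omega> n) (last_coin \<omega> n)"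
      using potential_step[OF reg st] unfolding potential_upd cost_upd
      by (simp add: add_divide_distrib add.assoc)
  qed
  also have "\<dots> \<le> (2 - \<gamma>) * breg xstar x0" using Suc by simp
  finally show ?case .
qed

lemma expected_cost:
  "measure_pmf.expectation (outcomes S) (\<lambda>\<omega>. cost \<omega> S) \<le> C * (2 - \<gamma>) * breg xstar x0"
proof (cases S)
  case 0
  have "0 \<le> C * (2 - \<gamma>) * breg xstar x0"
    using C_pos \<gamma>_less breg_nonneg[OF xstar x0_doms] by simp
  then show ?thesis by (simp add: 0 cost_def)
next
  case (Suc n)
  then have n: "n < S" by simp
  note fin = finite_outcomes[OF order_refl]
  have "0 \<le> measure_pmf.expectation (outcomes S) (\<lambda>\<omega>. potential (zs \<omega> S) (last_coin \<omega> S))"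
  proof -
    have "measure_pmf.expectation (outcomes n) (\<lambda>_. 0 :: real)
      \<le> measure_pmf.expectation (outcomes S) (\<lambda>\<omega>. potential (zs \<omega> S) (last_coin \<omega> S))"
      unfolding Suc expectation_outcomes_Suc[OF n] potential_upd
      using n by (intro expectation_mono_finite expected_potential_nonneg[OF run_regular]
          finite_outcomes run_steppable) auto
    then show ?thesis by simp
  qed
  then have "measure_pmf.expectation (outcomes S) (\<lambda>\<omega>. cost \<omega> S / C) \<le> (2 - \<gamma>) * breg xstar x0"
    using expected_cost_and_potential[OF order_refl] by (simp add: expectation_add_finite[OF fin])
  then show ?thesis using C_pos by (simp add: field_simps)
qed

end

section \<open>The step-size conditions\<close>

text \<open>With \<open>c = (\<gamma> - p) / (1 - p)\<close>, \<open>d = (1 - \<gamma>) / (1 - p)\<close> and \<open>\<theta> = 8 \<rho> Lf\<^sup>2 / \<alpha>\<close>, the quantity \<open>8 \<eta>\<close> is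
  \<open>8 (Lf\<^sup>2 / \<alpha>\<^sup>2) (\<sigma>\<^sub>1 / \<sigma>\<^sub>2) + \<theta>\<close>. The second step-size condition bounds it through \<open>c\<close>. Independently, the gradient term
  of \<open>\<sigma>\<^sub>2\<close> and the definition of \<open>\<sigma>\<^sub>1\<close> bound it by \<open>1 - 4 \<omega> / d\<close>, where \<open>\<omega>\<close> is the error scale, and this
  gives \<open>\<omega> (1 + 8 \<eta>) \<le> d / 4\<close>.\<close>

lemma step_size_budget:
  fixes L Lbar Lf \<rho> \<alpha> \<gamma> p \<sigma>\<^sub>1 \<sigma>\<^sub>2 B :: real
  assumes Lf: "Lf > 0" and \<rho>: "\<rho> > 0" and p: "0 < p" "p < 1" "p < \<gamma>" "\<gamma> < 1" and \<alpha>: "\<alpha> > 0"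
    and B: "B > 0"
    and \<sigma>\<^sub>1: "\<sigma>\<^sub>1 = (1 - \<gamma>) / (2 * (1 - p)) * (1 - 8 * \<rho> * Lf\<^sup>2 / \<alpha>)
              - (2 * \<alpha>\<^sup>2 * L\<^sup>2 + 8 * \<alpha> * \<rho> * L\<^sup>2 + 4 * \<alpha> * \<rho> * Lbar\<^sup>2 / B
                 + 5 * \<alpha>\<^sup>2 * Lbar\<^sup>2 / (2 * B))"
    and \<sigma>\<^sub>2: "\<sigma>\<^sub>2 = 8 * L\<^sup>2 + 4 * (1 - \<gamma>) * Lf\<^sup>2 / ((1 - p) * \<alpha>\<^sup>2) + 4 * Lbar\<^sup>2 / B"
    and \<sigma>\<^sub>1_pos: "\<sigma>\<^sub>1 > 0"
    and cond: "8 * (\<gamma> - p) * Lf\<^sup>2 / ((1 - p) * \<alpha>\<^sup>2)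
              - \<sigma>\<^sub>2 / \<sigma>\<^sub>1 * ((\<gamma> - p) / (1 - p) * (1 - 8 * \<rho> * Lf\<^sup>2 / \<alpha>) - 1 / 2) \<le> 0"
    and \<eta>: "\<eta> = Lf\<^sup>2 / \<alpha>\<^sup>2 * (1 / (\<sigma>\<^sub>2 / \<sigma>\<^sub>1) + \<alpha> * \<rho>)"
  shows "\<sigma>\<^sub>2 / \<sigma>\<^sub>1 > 0" "\<eta> \<ge> 0" "1 / 2 < (\<gamma> - p) / (1 - p)"
    "1 / (\<sigma>\<^sub>2 / \<sigma>\<^sub>1) + \<alpha> * \<rho> = \<alpha>\<^sup>2 / Lf\<^sup>2 * \<eta>"
    "8 * \<eta> \<le> 1 - 1 / (2 * ((\<gamma> - p) / (1 - p)))"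
    "(\<alpha>\<^sup>2 * L\<^sup>2 + \<alpha>\<^sup>2 * Lbar\<^sup>2 / B) * (1 + 8 * \<eta>) \<le> (1 - \<gamma>) / (1 - p) / 4"
proof -
  define c d \<theta> k W V C where "c = (\<gamma> - p) / (1 - p)" and "d = (1 - \<gamma>) / (1 - p)"
    and "\<theta> = 8 * \<rho> * Lf\<^sup>2 / \<alpha>" and "k = Lf\<^sup>2 / \<alpha>\<^sup>2"
    and "W = \<alpha>\<^sup>2 * L\<^sup>2" and "V = \<alpha>\<^sup>2 * Lbar\<^sup>2 / B" and "C = \<sigma>\<^sub>2 / \<sigma>\<^sub>1"
  have pos: "c > 0" "d > 0" "\<theta> > 0" "k > 0" "W \<ge> 0" "V \<ge> 0"
    using assms by (simp_all add: c_def d_def \<theta>_def k_def W_def V_def)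
  have s2: "\<sigma>\<^sub>2 = 8 * L\<^sup>2 + 4 * d * k + 4 * Lbar\<^sup>2 / B"
    using p by (simp add: \<sigma>\<^sub>2 d_def k_def)
  have s2_ge: "4 * d * k \<le> \<sigma>\<^sub>2" using B by (simp add: s2)
  have dk: "0 < d * k" using pos by simp
  have s2_pos: "\<sigma>\<^sub>2 > 0" using s2_ge dk by linarith
  show C: "\<sigma>\<^sub>2 / \<sigma>\<^sub>1 > 0" using s2_pos \<sigma>\<^sub>1_pos by simp
  have "0 \<le> 8 * \<alpha> * \<rho> * L\<^sup>2" "0 \<le> 4 * \<alpha> * \<rho> * Lbar\<^sup>2 / B" using \<alpha> \<rho> B by simp_all
  moreover have "5 * \<alpha>\<^sup>2 * Lbar\<^sup>2 / (2 * B) = 5 / 2 * V" "2 * \<alpha>\<^sup>2 * L\<^sup>2 = 2 * W"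
    by (simp_all add: V_def W_def)
  moreover have "(1 - \<gamma>) / (2 * (1 - p)) * (1 - 8 * \<rho> * Lf\<^sup>2 / \<alpha>) = d / 2 * (1 - \<theta>)"
    by (simp add: d_def \<theta>_def)
  moreover from calculation have "\<sigma>\<^sub>1 = d / 2 * (1 - \<theta>)
      - (2 * W + 8 * \<alpha> * \<rho> * L\<^sup>2 + 4 * \<alpha> * \<rho> * Lbar\<^sup>2 / B + 5 / 2 * V)"
    by (simp only: \<sigma>\<^sub>1)
  ultimately have s1_le: "\<sigma>\<^sub>1 \<le> d / 2 * (1 - \<theta>) - 2 * (W + V)"
    using pos(6) by argo
  have "\<eta> = k / C + k * \<alpha> * \<rho>"
    by (simp add: \<eta> k_def C_def distrib_left)
  moreover have "8 * (k * \<alpha> * \<rho>) = \<theta>" using \<alpha> by (simp add: k_def \<theta>_def power2_eq_square)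
  ultimately have \<eta>8: "8 * \<eta> = 8 * (k / C) + \<theta>" by simp
  have "0 < k / C" using pos C by (simp only: C_def divide_pos_pos)
  then show "\<eta> \<ge> 0" using \<eta>8 pos by linarith
  show "1 / (\<sigma>\<^sub>2 / \<sigma>\<^sub>1) + \<alpha> * \<rho> = \<alpha>\<^sup>2 / Lf\<^sup>2 * \<eta>" using Lf \<alpha> by (simp add: \<eta>)
  have "8 * (\<gamma> - p) * Lf\<^sup>2 / ((1 - p) * \<alpha>\<^sup>2) = 8 * (c * k)"
    by (simp add: c_def k_def)
  then have "8 * (c * k) \<le> C * (c * (1 - \<theta>) - 1 / 2)"
    using cond[folded c_def C_def \<theta>_def] by linarith
  then have slack: "8 * (c * k) / C \<le> c * (1 - \<theta>) - 1 / 2"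
    using C by (simp add: C_def[symmetric] pos_divide_le_eq mult.commute)
  have ck: "0 < 8 * (c * k) / C" using pos C by (simp add: C_def[symmetric])
  have "c * (8 * \<eta>) = 8 * (c * k) / C + c * \<theta>"
    by (simp only: \<eta>8) (simp add: distrib_left)
  then have "c * (8 * \<eta>) \<le> c - 1 / 2" using slack by (simp add: algebra_simps)
  then have "8 * \<eta> \<le> (c - 1 / 2) / c" using pos(1) by (simp add: pos_le_divide_eq mult.commute)
  then show "8 * \<eta> \<le> 1 - 1 / (2 * ((\<gamma> - p) / (1 - p)))"
    using pos(1) unfolding c_def[symmetric] by (simp add: diff_divide_distrib)
  have "0 < c * \<theta>" using pos by simp
  then show "1 / 2 < (\<gamma> - p) / (1 - p)"
    using slack ck unfolding c_def[symmetric] by (simp add: algebra_simps)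
  have "8 * (k / C) = 8 * (k * \<sigma>\<^sub>1) / \<sigma>\<^sub>2" by (simp add: C_def)
  also have "\<dots> \<le> 8 * (k * \<sigma>\<^sub>1) / (4 * d * k)"
    using s2_ge s2_pos pos \<sigma>\<^sub>1_pos by (intro divide_left_mono mult_pos_pos) auto
  also have "\<dots> = 2 * \<sigma>\<^sub>1 / d" using pos by simp
  also have "\<dots> \<le> 2 * (d / 2 * (1 - \<theta>) - 2 * (W + V)) / d"
    using s1_le pos by (intro divide_right_mono mult_left_mono) auto
  also have "\<dots> = (1 - \<theta>) - 4 * (W + V) / d"
    using pos(2) by (simp add: divide_simps)
  finally have "8 * \<eta> \<le> 1 - 4 * (W + V) / d" using \<eta>8 by simp
  then have "d * (8 * \<eta>) \<le> d * (1 - 4 * (W + V) / d)" using pos by (intro mult_left_mono) auto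
  also have "\<dots> = d - 4 * (W + V)" using pos(2) by (simp add: right_diff_distrib)
  finally have WV: "W + V \<le> d / 4 * (1 - 8 * \<eta>)" by (simp add: algebra_simps)
  have "(W + V) * (1 + 8 * \<eta>) \<le> d / 4 * (1 - 8 * \<eta>) * (1 + 8 * \<eta>)"
    using WV \<open>\<eta> \<ge> 0\<close> by (intro mult_right_mono) auto
  also have "\<dots> = d / 4 * (1 - (8 * \<eta>)\<^sup>2)" by (simp add: power2_eq_square algebra_simps)
  also have "\<dots> \<le> d / 4 * 1" using pos by (intro mult_left_mono) auto
  finally show "(\<alpha>\<^sup>2 * L\<^sup>2 + \<alpha>\<^sup>2 * Lbar\<^sup>2 / B) * (1 + 8 * \<eta>) \<le> (1 - \<gamma>) / (1 - p) / 4"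
    by (simp add: W_def V_def d_def)
qed

section \<open>The residual bound\<close>

theorem theorem3p4:
  fixes N :: "'a::euclidean_space \<Rightarrow> real"
    and K :: "'a set"
    and g f :: "'a \<Rightarrow> ereal"
    and gradf F :: "'a \<Rightarrow> 'a"
    and Fi Fo :: "nat \<Rightarrow> 'a \<Rightarrow> 'a"
    and Q :: "'a \<Rightarrow> 'a \<Rightarrow> nat pmf"
    and M b S :: nat
    and L Lbar L\<^sub>f \<rho> \<alpha> \<gamma> p \<sigma>\<^sub>1 \<sigma>\<^sub>2 :: real
    and xstar x0 :: 'a
    and zs :: "(nat \<Rightarrow> nat list \<times> bool) \<Rightarrow> nat \<Rightarrow> 'a iterate"
    and P :: "(nat \<Rightarrow> nat list \<times> bool) pmf"
    and \<Delta> u :: "(nat \<Rightarrow> nat list \<times> bool) \<Rightarrow> nat \<Rightarrow> 'a"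
  assumes norm: "is_norm N"
    and K: "K \<noteq> {}" "closed K" "convex K"
    and g: "proper_convex_lsc K g"
    and f: "proper_convex_lsc K f"
    and dom: "edom K g \<subseteq> edom K f"
    and grad: "has_gradient K f gradf"
    and strong: "strongly_convex1 N K f gradf"
    and M: "M \<ge> 1"
    and finite_sum: "\<And>x. x \<in> edom K g \<Longrightarrow> F x = (1 / real M) *\<^sub>R (\<Sum>i=1..M. Fi i x)"
    and A1: "vi_solutions K g F \<noteq> {}"
    and A3: "lipschitz_in_mean_oracle N M (edom K g) F Fo Q Lbar"
    and A4: "\<And>x y. x \<in> K \<Longrightarrow> y \<in> K \<Longrightarrow> dual_norm N (F x - F y) \<le> L * N (x - y)"
    and A5: "xstar \<in> K" "\<rho> > 0"
      "\<And>x v. x \<in> K \<Longrightarrow> v \<in> subdifferential (\<lambda>z. g z + indicator_ext K z) x \<Longrightarrow>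
         - \<rho> * (dual_norm N (F x + v))\<^sup>2 \<le> (F x + v) \<bullet> (x - xstar)"
    and A6: "L\<^sub>f > 0"
      "\<And>x y. x \<in> K \<Longrightarrow> y \<in> K \<Longrightarrow> dual_norm N (gradf x - gradf y) \<le> L\<^sub>f * N (x - y)"
    and params: "0 < p" "p < 1" "p < \<gamma>" "\<gamma> < 1" "\<alpha> > 0" "b \<in> {1..M}"
    and x0: "x0 \<in> edom K g"
    and zs: "zs = iterates K g f gradf F Fo \<alpha> \<gamma> x0"
    and P: "P = outcome_pmf Q p b zs S"
    and \<Delta>: "\<Delta> = (\<lambda>\<omega> s. direction F Fo (fst (\<omega> s)) (zs \<omega> s))"
    and well_defined_x:
      "\<And>\<omega> s. \<omega> \<in> set_pmf P \<Longrightarrow> s \<le> S \<Longrightarrow> xcur (zs \<omega> s) \<in> dom_subdiff K f"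
    and well_defined_xbar:
      "\<And>\<omega> s. \<omega> \<in> set_pmf P \<Longrightarrow> s < S \<Longrightarrow> mixed_gradient gradf \<gamma> (zs \<omega> s) \<in> gradf ` dom_subdiff K f"
    and well_defined_argmin:
      "\<And>\<omega> s. \<omega> \<in> set_pmf P \<Longrightarrow> s < S \<Longrightarrow>
         \<exists>x. is_arg_min (prox_objective g f gradf \<alpha> (\<Delta> \<omega> s) (xbar K f gradf \<gamma> (zs \<omega> s))) (\<lambda>x. x \<in> K) x"
    and u: "u = (\<lambda>\<omega> s. F (xcur (zs \<omega> (Suc s))) - \<Delta> \<omega> s
              - (1 / \<alpha>) *\<^sub>R (gradf (xcur (zs \<omega> (Suc s)))
                  - (\<gamma> *\<^sub>R gradf (xcur (zs \<omega> s)) + (1 - \<gamma>) *\<^sub>R gradf (xprev (zs \<omega> s)))))"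
    and \<sigma>\<^sub>1: "\<sigma>\<^sub>1 = (1 - \<gamma>) / (2 * (1 - p)) * (1 - 8 * \<rho> * L\<^sub>f\<^sup>2 / \<alpha>)
              - (2 * \<alpha>\<^sup>2 * L\<^sup>2 + 8 * \<alpha> * \<rho> * L\<^sup>2 + 4 * \<alpha> * \<rho> * Lbar\<^sup>2 / real b
                 + 5 * \<alpha>\<^sup>2 * Lbar\<^sup>2 / (2 * real b))"
    and \<sigma>\<^sub>2: "\<sigma>\<^sub>2 = 8 * L\<^sup>2 + 4 * (1 - \<gamma>) * L\<^sub>f\<^sup>2 / ((1 - p) * \<alpha>\<^sup>2) + 4 * Lbar\<^sup>2 / real b"
    and \<sigma>\<^sub>1_pos: "\<sigma>\<^sub>1 > 0"
    and \<sigma>_cond: "8 * (\<gamma> - p) * L\<^sub>f\<^sup>2 / ((1 - p) * \<alpha>\<^sup>2)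
              - \<sigma>\<^sub>2 / \<sigma>\<^sub>1 * ((\<gamma> - p) / (1 - p) * (1 - 8 * \<rho> * L\<^sub>f\<^sup>2 / \<alpha>) - 1 / 2) \<le> 0"
  shows "ereal (measure_pmf.expectation P (\<lambda>\<omega>. \<Sum>s<S. (dual_norm N (u \<omega> s))\<^sup>2))
           \<le> ereal ((3 - \<gamma>) * \<sigma>\<^sub>2 / \<sigma>\<^sub>1) * bregman f gradf xstar x0"
proof -
  have x0f: "x0 \<in> edom K f" using x0 dom by blast
  have fin: "\<bar>f x0\<bar> \<noteq> \<infinity>"
    using f x0f by (auto simp: proper_convex_lsc_def edom_def)
  define \<eta> where "\<eta> = L\<^sub>f\<^sup>2 / \<alpha>\<^sup>2 * (1 / (\<sigma>\<^sub>2 / \<sigma>\<^sub>1) + \<alpha> * \<rho>)"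
  have b: "real b > 0" using params(6) by simp
  note sizes = step_size_budget[OF A6(1) A5(2) params(1-5) b \<sigma>\<^sub>1 \<sigma>\<^sub>2 \<sigma>\<^sub>1_pos \<sigma>_cond \<eta>_def]
  have pos: "(3 - \<gamma>) * \<sigma>\<^sub>2 / \<sigma>\<^sub>1 > 0"
    using sizes(1) params(4) mult_pos_pos[of "3 - \<gamma>" "\<sigma>\<^sub>2 / \<sigma>\<^sub>1"] by simp
  show ?thesis
  proof (cases "xstar \<in> edom K f")
    case False
    \<comment> \<open>the right-hand side is infinite\<close>
    then have "f xstar = \<infinity>" using A5(1) by (simp add: edom_def)
    then have "bregman f gradf xstar x0 = \<infinity>" using fin by (cases "f x0") (simp_all add: bregman_def)
    moreover have "ereal c * \<infinity> = \<infinity>" if "c > 0" for c using that by simp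
    ultimately show ?thesis using pos by (simp only: ereal_less_eq(1))
  next
    case True
    interpret mirror_map N K f gradf
      by unfold_locales (use norm K f grad strong in auto)
    interpret variance_reduced_method N K f gradf g F Fo Q M b L Lbar L\<^sub>f \<rho> \<alpha> \<gamma> p xstar
      by unfold_locales (use g dom A3 A4 A5 A6 params True b in auto)
    interpret variance_reduced_rate N K f gradf g F Fo Q M b L Lbar L\<^sub>f \<rho> \<alpha> \<gamma> p xstar "\<sigma>\<^sub>2 / \<sigma>\<^sub>1" \<eta>
      by unfold_locales (use sizes in \<open>simp_all only: \<omega>\<^sub>L_def\<close>)
    interpret variance_reduced_run N K f gradf g F Fo Q M b L Lbar L\<^sub>f \<rho> \<alpha> \<gamma> p xstar "\<sigma>\<^sub>2 / \<sigma>\<^sub>1" \<eta> x0 S zs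
      by unfold_locales
        (use zs x0 well_defined_x well_defined_xbar well_defined_argmin in \<open>simp_all add: P \<Delta>\<close>)
    have "u \<omega> s = residual (zs \<omega> s) (fst (\<omega> s))" for \<omega> s
      by (simp add: u \<Delta> residual_def mixed_gradient_def zs_Suc)
    then have "measure_pmf.expectation P (\<lambda>\<omega>. \<Sum>s<S. (dual_norm N (u \<omega> s))\<^sup>2)
      = measure_pmf.expectation (outcomes S) (\<lambda>\<omega>. cost \<omega> S)"
      by (simp add: P outcomes_def cost_def)
    also have "\<dots> \<le> \<sigma>\<^sub>2 / \<sigma>\<^sub>1 * (2 - \<gamma>) * breg xstar x0" by (rule expected_cost)
    also have "\<dots> \<le> \<sigma>\<^sub>2 / \<sigma>\<^sub>1 * (3 - \<gamma>) * breg xstar x0"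
      using sizes(1) breg_nonneg[OF True x0_doms]
      by (intro mult_right_mono mult_left_mono) auto
    finally show ?thesis
      by (simp add: bregman_eq_breg[OF True x0f] mult.commute)
  qed
qed

end
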